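(* Let $n\in\mathbb{N}$, $s\in\mathbb{R}$ and $p,q\in(0,\infty]$. (i) Let $\tau\in(1/p,\infty)$. Then $\mathcal{X}\in B^{s,\tau}_{p,q}(\mathbb{R}^n)$ if and only if $s\le n(1/p-\tau)$. (ii) Let $\tau\in[0,1/p]$ (with $\tau<\infty$). Then $\mathcal{X}\in B^{s,\tau}_{p,q}(\mathbb{R}^n)$ if and only if either $$s=\frac1p,\qquad q=\infty\qquad\text{and}\qquad s\le n\left(\frac1p-\tau\right)$$ or $$s<\frac1p,\qquad q\in(0,\infty]\qquad\text{and}\qquad s\le n\left(\frac1p-\tau\right).$$ (iii) Let $\tau\in[0,\infty)$. All elements of the Haar system $H$ have the same smoothness properties with respect to Besov-type spaces, i.e., for arbitrary $i\in\{1,\ldots,2^n-1\}$, $j\in\mathbb{N}_0$ and $m\in\mathbb{Z}^n$: $h_{i,j,m}\in B^{s,\tau}_{p,q}(\mathbb{R}^n)$ if and only if $\mathcal{X}_{0,m}\in B^{s,\tau}_{p,q}(\mathbb{R}^n)$ if and only if $\mathcal{X}\in B^{s,\tau}_{p,q}(\mathbb{R}^n)$.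
   Context: Conventions: $\mathbb{N}_0=\mathbb{N}\cup\{0\}$; $1/p:=0$ if $p=\infty$. Functions are complex-valued; locally integrable functions such as those below are regarded as tempered distributions. The Fourier transform is $\mathcal{F}\varphi(\xi)=(2\pi)^{-n/2}\int_{\mathbb{R}^n}e^{-\iota x\xi}\varphi(x)\,dx$ ($\iota=\sqrt{-1}$), extended to $\mathcal{S}'(\mathbb{R}^n)$. Besov-type space. Let $\varphi_0,\varphi\in\mathcal{S}(\mathbb{R}^n)$ satisfy, for some constant $C>0$: $\operatorname{supp}\mathcal{F}\varphi_0\subset\{|\xi|\le2\}$, $|\mathcal{F}\varphi_0(\xi)|\ge C$ if $|\xi|\le 5/3$; $\operatorname{supp}\mathcal{F}\varphi\subset\{1/2\le|\xi|\le2\}$, $|\mathcal{F}\varphi(\xi)|\ge C$ if $3/5\le|\xi|\le5/3$. For $j\in\mathbb{N}$ put $\varphi_j:=2^{jn}\varphi(2^j\cdot)$. Let $\mathcal{Q}:=\{Q_{j,k}:=2^{-j}([0,1)^n+k):\ j\in\mathbb{Z},\,k\in\mathbb{Z}^n\}$ be the dyadic cubes, $\ell(Q)$ the side length of $Q$, and $j_Q:=-\log_2\ell(Q)$. For $s\in\mathbb{R}$, $\tau\in[0,\infty)$, $p,q\in(0,\infty]$, $B^{s,\tau}_{p,q}(\mathbb{R}^n)$ is the space of all $f\in\mathcal{S}'(\mathbb{R}^n)$ with $$\|f\|_{B^{s,\tau}_{p,q}(\mathbb{R}^n)}:=\sup_{P\in\mathcal{Q}}\frac1{|P|^\tau}\left\{\sum_{j=\max\{j_P,0\}}^\infty2^{jsq}\left[\int_P|\varphi_j*f(x)|^p\,dx\right]^{q/p}\right\}^{1/q}<\infty,$$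 with the usual modifications if $p=\infty$ and/or $q=\infty$. Haar system. Let $\widetilde{\mathcal{X}}$ be the characteristic function of $[0,1)$ and $\widetilde h$ the function equal to $1$ on $[0,1/2)$, $-1$ on $[1/2,1)$ and $0$ elsewhere. For $\varepsilon\in\{0,1\}^n$ let $h_\varepsilon(x):=\prod_{i:\varepsilon_i=0}\widetilde{\mathcal{X}}(x_i)\prod_{i:\varepsilon_i=1}\widetilde h(x_i)$. Write $\mathcal{X}:=h_{(0,\ldots,0)}$ (the characteristic function of $[0,1)^n$) and enumerate the remaining $2^n-1$ functions as $h_1,\ldots,h_{2^n-1}$. Put $\mathcal{X}_{j,m}:=2^{jn/2}\mathcal{X}(2^j\cdot-m)$, $h_{i,j,m}:=2^{jn/2}h_i(2^j\cdot-m)$ for $j\in\mathbb{N}_0$, $m\in\mathbb{Z}^n$, and $H:=\{\mathcal{X}_{0,m},h_{i,j,m}:\ i\in\{1,\ldots,2^n-1\},\,j\in\mathbb{N}_0,\,m\in\mathbb{Z}^n\}$. *)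

theory Defs
  imports "HOL-Analysis.Analysis" "HOL-Probability.Essential_Supremum"
begin

section \<open>Schwartz functions and tempered distributions\<close>

definition partial_deriv :: "'n::finite \<Rightarrow> (real^'n \<Rightarrow> complex) \<Rightarrow> real^'n \<Rightarrow> complex" where
  "partial_deriv i f x = frechet_derivative f (at x) (axis i 1)"

text \<open>A multi-index is given as the list of the coordinates to differentiate along; the entry
  \<open>\<alpha>\<^sub>i\<close> of the usual multi-index is the number of occurrences of \<open>i\<close> in the list.\<close>

definition deriv_list :: "'n::finite list \<Rightarrow> (real^'n \<Rightarrow> complex) \<Rightarrow> real^'n \<Rightarrow> complex" where
  "deriv_list is f = foldr partial_deriv is f"

definition Schwartz :: "(real^'n::finite \<Rightarrow> complex) set" where
  "Schwartz = {f. \<forall>is. (\<forall>x. deriv_list is f differentiable (at x)) \<and>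
     (\<forall>N::nat. bounded (range (\<lambda>x. (1 + norm x) ^ N *\<^sub>R deriv_list is f x)))}"

definition Schwartz_seminorm :: "nat \<Rightarrow> 'n::finite list \<Rightarrow> (real^'n \<Rightarrow> complex) \<Rightarrow> real" where
  "Schwartz_seminorm N is f = (SUP x. (1 + norm x) ^ N * norm (deriv_list is f x))"

definition Schwartz_topology :: "(real^'n::finite \<Rightarrow> complex) topology" where
  "Schwartz_topology = topology_generated_by
     {{g \<in> Schwartz. Schwartz_seminorm N is (\<lambda>x. g x - f x) < r} | f N is r. f \<in> Schwartz \<and> r > 0}"

text \<open>Distributions are set to \<open>undefined\<close> outside \<open>Schwartz\<close>, so that they are determined by
  their values on \<open>Schwartz\<close>.\<close>

definition tempered_distributions :: "((real^'n::finite \<Rightarrow> complex) \<Rightarrow> complex) set" where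
  "tempered_distributions = {T \<in> extensional Schwartz.
     (\<forall>f\<in>Schwartz. \<forall>g\<in>Schwartz. \<forall>a b. T (\<lambda>x. a * f x + b * g x) = a * T f + b * T g) \<and>
     continuous_map Schwartz_topology euclidean T}"

definition regular_dist ::
  "(real^'n::finite \<Rightarrow> complex) \<Rightarrow> (real^'n \<Rightarrow> complex) \<Rightarrow> complex" where
  "regular_dist f = restrict (\<lambda>\<psi>. LINT x|lborel. f x * \<psi> x) Schwartz"

definition convolution_dist ::
  "(real^'n::finite \<Rightarrow> complex) \<Rightarrow> ((real^'n \<Rightarrow> complex) \<Rightarrow> complex) \<Rightarrow> real^'n \<Rightarrow> complex" where
  "convolution_dist \<psi> T x = T (\<lambda>y. \<psi> (x - y))"

definition fourier :: "(real^'n::finite \<Rightarrow> complex) \<Rightarrow> real^'n \<Rightarrow> complex" where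
  "fourier f \<xi> = complex_of_real ((2 * pi) powr (- real CARD('n) / 2)) *
     (LINT x|lborel. exp (- (\<i> * complex_of_real (x \<bullet> \<xi>))) * f x)"

definition support :: "(real^'n::finite \<Rightarrow> complex) \<Rightarrow> (real^'n) set" where
  "support f = closure {x. f x \<noteq> 0}"

section \<open>Besov-type spaces\<close>

definition admissible_pair ::
  "(real^'n::finite \<Rightarrow> complex) \<Rightarrow> (real^'n \<Rightarrow> complex) \<Rightarrow> bool" where
  "admissible_pair \<phi>0 \<phi> \<longleftrightarrow> \<phi>0 \<in> Schwartz \<and> \<phi> \<in> Schwartz \<and>
     (\<exists>C>0. support (fourier \<phi>0) \<subseteq> {\<xi>. norm \<xi> \<le> 2} \<and>
            (\<forall>\<xi>. norm \<xi> \<le> 5/3 \<longrightarrow> norm (fourier \<phi>0 \<xi>) \<ge> C) \<and>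
            support (fourier \<phi>) \<subseteq> {\<xi>. 1/2 \<le> norm \<xi> \<and> norm \<xi> \<le> 2} \<and>
            (\<forall>\<xi>. 3/5 \<le> norm \<xi> \<and> norm \<xi> \<le> 5/3 \<longrightarrow> norm (fourier \<phi> \<xi>) \<ge> C))"

definition phi_seq ::
  "(real^'n::finite \<Rightarrow> complex) \<Rightarrow> (real^'n \<Rightarrow> complex) \<Rightarrow> nat \<Rightarrow> real^'n \<Rightarrow> complex" where
  "phi_seq \<phi>0 \<phi> j =
     (if j = 0 then \<phi>0 else (\<lambda>x. 2 ^ (j * CARD('n)) * \<phi> (2 ^ j *\<^sub>R x)))"

definition dyadic_cube :: "int \<Rightarrow> int^'n::finite \<Rightarrow> (real^'n) set" where
  "dyadic_cube j k =
     (\<lambda>x. (2 powi (- j)) *\<^sub>R (x + (\<chi> i. of_int (k $ i)))) ` {x. \<forall>i. 0 \<le> x $ i \<and> x $ i < 1}"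

text \<open>Powers with exponent \<open>a > 0\<close>.\<close>

definition ennreal_power :: "ennreal \<Rightarrow> real \<Rightarrow> ennreal" where
  "ennreal_power x a = (if x = \<infinity> then \<infinity> else ennreal (enn2real x powr a))"

definition Lp_norm :: "ennreal \<Rightarrow> (real^'n::finite) set \<Rightarrow> (real^'n \<Rightarrow> complex) \<Rightarrow> ennreal" where
  "Lp_norm p P g =
     (if p = \<infinity> then esssup (restrict_space lborel P) (\<lambda>x. ennreal (norm (g x)))
      else ennreal_power (\<integral>\<^sup>+x\<in>P. ennreal (norm (g x) powr enn2real p) \<partial>lborel) (1 / enn2real p))"

definition lq_norm :: "ennreal \<Rightarrow> (nat \<Rightarrow> ennreal) \<Rightarrow> ennreal" where
  "lq_norm q b =
     (if q = \<infinity> then (SUP i. b i)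
      else ennreal_power (\<Sum>i. ennreal_power (b i) (enn2real q)) (1 / enn2real q))"

text \<open>The supremum runs over the cubes \<open>P = dyadic_cube J k\<close>, for which \<open>j\<^sub>P = J\<close>; the index
  \<open>j = nat J + i\<close> runs over all \<open>j \<ge> max J 0\<close>.\<close>

definition besov_type_norm ::
  "(real^'n::finite \<Rightarrow> complex) \<Rightarrow> (real^'n \<Rightarrow> complex) \<Rightarrow> real \<Rightarrow> real \<Rightarrow> ennreal \<Rightarrow> ennreal \<Rightarrow>
   ((real^'n \<Rightarrow> complex) \<Rightarrow> complex) \<Rightarrow> ennreal" where
  "besov_type_norm \<phi>0 \<phi> s \<tau> p q f =
     (SUP (J, k) \<in> (UNIV :: (int \<times> (int^'n)) set).
        ennreal (1 / measure lborel (dyadic_cube J k) powr \<tau>) *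
        lq_norm q (\<lambda>i. let j = nat J + i in
          ennreal (2 powr (real j * s)) *
          Lp_norm p (dyadic_cube J k) (convolution_dist (phi_seq \<phi>0 \<phi> j) f)))"

definition besov_type ::
  "(real^'n::finite \<Rightarrow> complex) \<Rightarrow> (real^'n \<Rightarrow> complex) \<Rightarrow> real \<Rightarrow> real \<Rightarrow> ennreal \<Rightarrow> ennreal \<Rightarrow>
   ((real^'n \<Rightarrow> complex) \<Rightarrow> complex) set" where
  "besov_type \<phi>0 \<phi> s \<tau> p q =
     {f \<in> tempered_distributions. besov_type_norm \<phi>0 \<phi> s \<tau> p q f < \<infinity>}"

text \<open>\<open>1/p\<close> as a real number, with \<open>1/\<infinity> = 0\<close>.\<close>

definition recip :: "ennreal \<Rightarrow> real" where
  "recip p = enn2real (1 / p)"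

section \<open>The Haar system\<close>

definition X_tilde :: "real \<Rightarrow> complex" where
  "X_tilde = indicator {0..<1}"

definition h_tilde :: "real \<Rightarrow> complex" where
  "h_tilde t = indicator {0..<1/2} t - indicator {1/2..<1} t"

text \<open>A vector \<open>\<epsilon> \<in> {0,1}\<^sup>n\<close> is given by Booleans, with \<open>True\<close> for 1. The functions
  \<open>h\<^sub>1, \<dots>, h\<^sub>N\<close> with \<open>N = 2\<^sup>n - 1\<close> are the functions \<open>haar_gen \<epsilon>\<close> with \<open>\<epsilon> \<noteq> (\<chi> i. False)\<close>.\<close>

definition haar_gen :: "bool^'n::finite \<Rightarrow> real^'n \<Rightarrow> complex" where
  "haar_gen \<epsilon> x =
     (\<Prod>i | \<not> \<epsilon> $ i. X_tilde (x $ i)) * (\<Prod>i | \<epsilon> $ i. h_tilde (x $ i))"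

definition haar :: "bool^'n::finite \<Rightarrow> nat \<Rightarrow> int^'n \<Rightarrow> real^'n \<Rightarrow> complex" where
  "haar \<epsilon> j m x = complex_of_real (2 powr (real (j * CARD('n)) / 2)) *
     haar_gen \<epsilon> (2 ^ j *\<^sub>R x - (\<chi> i. of_int (m $ i)))"

definition X_cube :: "real^'n::finite \<Rightarrow> complex" where
  "X_cube = haar_gen (\<chi> i. False)"

definition X_shift :: "nat \<Rightarrow> int^'n::finite \<Rightarrow> real^'n \<Rightarrow> complex" where
  "X_shift j m = haar (\<chi> i. False) j m"

end

(* Let r = 1/p. Every function f of the Haar system, the characteristic function of the cube included,
   lies in the space iff s <= n (r - tau) and either s < r, or s = r and q = infinity; for tau > r the
   second condition follows from the first.

   As phi has integral zero and f is constant away from finitely many walls x_i = a, the function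
   phi_j * f is concentrated in a strip of width 2^(-j) around the walls. Hence its L^p norm on a
   dyadic cube of side 2^(-J) is at most of order 2^(-(j + max J 0 * (n - 1)) r), and summing the
   resulting geometric series gives sufficiency. For necessity, take small dyadic cubes touching the
   middle of a face of the cube that carries f. There f is c times the indicator of a half-space, and
   phi_j * f(x) is c * Phi(2^j (x_i - z_i)) up to O(2^(-j)), where Phi(t) is the integral of phi over
   v_i <= t. Since the Fourier transform of phi is nonzero on part of each axis, Phi is bounded away
   from zero on an interval avoiding 0, so the order above is attained. *)
theory Submission
  imports Defs "HOL-Probability.Distribution_Functions" "HOL-Probability.Sinc_Integral"
begin

section \<open>Schwartz functions\<close>

text \<open>Each condition on s belongs to one of two independent parameters. For J \<ge> 0 and j =
  J + i the weighted term is at most of size 2^(J (s - n (r - \<tau>)) + i (s - r)), and suitable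
  cubes attain this: the supremum over J forces the coefficient of J to be nonpositive, and the sum
  over i decides between s < r and s = r with q = \<infinity>. Cubes with J < 0 give nothing new,
  because f has compact support and the norm over the whole space is already finite; the decay used
  for this must be of arbitrary order, as p may be close to 0. The strip estimate for j \<ge> 1
  rests on cancellation, which \<open>\<phi>0\<close> lacks; at j = 0 the strip has width 1 and
  rapid decay replaces cancellation. The lower bound must hold for all j \<ge> J + L with L
  independent of J, so that either parameter can tend to infinity alone. This selects the base
  point: dyadic coordinates, so that it is a corner of a cube at every fine level, and a positive
  distance from all other walls. It is also placed where the sign change of the Haar functions is
  not seen, so that one argument covers all of them.\<close>

lemma deriv_list_affine:
  fixes f :: "real^'n::finite \<Rightarrow> complex"
  assumes "f \<in> Schwartz"
  shows "deriv_list is (\<lambda>y. a * f (x0 + c *\<^sub>R y)) =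
    (\<lambda>y. a * of_real c ^ length is * deriv_list is f (x0 + c *\<^sub>R y))"
proof (induction "is")
  case Nil
  show ?case by (simp add: deriv_list_def)
next
  case (Cons i js)
  let ?g = "deriv_list js f"
  show ?case
  proof
    fix y
    have "?g differentiable (at (x0 + c *\<^sub>R y))"
      using assms unfolding Schwartz_def by auto
    then obtain D where D: "(?g has_derivative D) (at (x0 + c *\<^sub>R y))"
      by (auto simp: differentiable_def)
    have Dfd: "D = frechet_derivative ?g (at (x0 + c *\<^sub>R y))"
      using D by (rule frechet_derivative_at)
    have "((\<lambda>y. x0 + c *\<^sub>R y) has_derivative (\<lambda>h. c *\<^sub>R h)) (at y)"
      by (auto intro!: derivative_eq_intros)
    from has_derivative_compose[OF this D]
    have "((\<lambda>y. a * of_real c ^ length js * ?g (x0 + c *\<^sub>R y)) has_derivative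
        (\<lambda>h. a * of_real c ^ length js * D (c *\<^sub>R h))) (at y)"
      by (intro has_derivative_mult_right)
    then have "frechet_derivative (\<lambda>y. a * of_real c ^ length js * ?g (x0 + c *\<^sub>R y)) (at y) =
        (\<lambda>h. a * of_real c ^ length js * D (c *\<^sub>R h))"
      by (rule frechet_derivative_at[symmetric])
    \<comment> \<open>The derivative is only real linear; as c is real, it still comes out as a
      complex factor.\<close>
    moreover have "D (c *\<^sub>R h) = of_real c * D h" for h
      using linear_cmul[OF bounded_linear.linear[OF has_derivative_bounded_linear[OF D]], of c h]
      by (metis scaleR_conv_of_real)
    ultimately show "deriv_list (i # js) (\<lambda>y. a * f (x0 + c *\<^sub>R y)) y =
        a * of_real c ^ length (i # js) * deriv_list (i # js) f (x0 + c *\<^sub>R y)"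
      using Cons.IH by (simp add: deriv_list_def partial_deriv_def Dfd mult_ac)
  qed
qed

lemma Schwartz_deriv_bound:
  fixes f :: "real^'n::finite \<Rightarrow> complex"
  assumes "f \<in> Schwartz"
  obtains K where "\<And>x. (1 + norm x) ^ N * norm (deriv_list is f x) \<le> K"
proof -
  have "bounded (range (\<lambda>x. (1 + norm x) ^ N *\<^sub>R deriv_list is f x))"
    using assms unfolding Schwartz_def by auto
  then obtain K where "\<And>x. norm ((1 + norm x) ^ N *\<^sub>R deriv_list is f x) \<le> K"
    unfolding bounded_iff by auto
  then show thesis using that[of K] by simp
qed

text \<open>Needed with x0 = 2^j x and c = -2^j: the function taking y to phi_j(x - y) is then a
  test function.\<close>

lemma Schwartz_affine:
  fixes f :: "real^'n::finite \<Rightarrow> complex"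
  assumes f: "f \<in> Schwartz" and c: "c \<noteq> 0"
  shows "(\<lambda>y. a * f (x0 + c *\<^sub>R y)) \<in> Schwartz"
  unfolding Schwartz_def deriv_list_affine[OF f] mem_Collect_eq
proof (intro allI conjI)
  fix "is" and y :: "real^'n"
  have "deriv_list is f differentiable (at (x0 + c *\<^sub>R y))"
    using f unfolding Schwartz_def by auto
  then obtain D where D: "(deriv_list is f has_derivative D) (at (x0 + c *\<^sub>R y))"
    by (auto simp: differentiable_def)
  have "((\<lambda>y. x0 + c *\<^sub>R y) has_derivative (\<lambda>h. c *\<^sub>R h)) (at y)"
    by (auto intro!: derivative_eq_intros)
  from has_derivative_compose[OF this D]
  have "(\<lambda>y. deriv_list is f (x0 + c *\<^sub>R y)) differentiable (at y)"
    by (rule differentiableI)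
  then show "(\<lambda>y. a * of_real c ^ length is * deriv_list is f (x0 + c *\<^sub>R y)) differentiable (at y)"
    by (intro differentiable_mult differentiable_const)
next
  fix "is" :: "'n list" and N :: nat
  obtain K where K: "\<And>x. (1 + norm x) ^ N * norm (deriv_list is f x) \<le> K"
    using Schwartz_deriv_bound[OF f] by blast
  \<comment> \<open>\<open>M\<close> dominates the ratio of the weight 1 + norm y to the weight at
    the transformed point.\<close>
  define M where "M = (1 + norm x0 / \<bar>c\<bar>) + 1 / \<bar>c\<bar>"
  have M: "1 + norm y \<le> M * (1 + norm (x0 + c *\<^sub>R y))" for y
  proof -
    have "norm (c *\<^sub>R y) \<le> norm (x0 + c *\<^sub>R y) + norm x0"
      using norm_triangle_ineq4[of "x0 + c *\<^sub>R y" x0] by simp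
    then have "norm y \<le> (norm (x0 + c *\<^sub>R y) + norm x0) / \<bar>c\<bar>"
      using c by (simp add: field_simps)
    then have "1 + norm y \<le> 1 + norm x0 / \<bar>c\<bar> + 1 / \<bar>c\<bar> * norm (x0 + c *\<^sub>R y)"
      by (simp add: add_divide_distrib)
    also have "\<dots> \<le> M * (1 + norm (x0 + c *\<^sub>R y))"
      unfolding M_def by (simp add: algebra_simps)
    finally show ?thesis .
  qed
  have "norm ((1 + norm y) ^ N *\<^sub>R (a * of_real c ^ length is * deriv_list is f (x0 + c *\<^sub>R y)))
      \<le> M ^ N * (norm a * \<bar>c\<bar> ^ length is) * K" for y
  proof -
    have "(1 + norm y) ^ N \<le> M ^ N * (1 + norm (x0 + c *\<^sub>R y)) ^ N"
      unfolding power_mult_distrib[symmetric] by (intro power_mono M) simp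
    then have "(1 + norm y) ^ N * norm (deriv_list is f (x0 + c *\<^sub>R y))
        \<le> M ^ N * (1 + norm (x0 + c *\<^sub>R y)) ^ N * norm (deriv_list is f (x0 + c *\<^sub>R y))"
      by (intro mult_right_mono) auto
    also have "\<dots> = M ^ N * ((1 + norm (x0 + c *\<^sub>R y)) ^ N * norm (deriv_list is f (x0 + c *\<^sub>R y)))"
      by simp
    also have "\<dots> \<le> M ^ N * K"
      by (intro mult_left_mono K) (simp add: M_def)
    finally have "norm a * \<bar>c\<bar> ^ length is * ((1 + norm y) ^ N * norm (deriv_list is f (x0 + c *\<^sub>R y)))
        \<le> norm a * \<bar>c\<bar> ^ length is * (M ^ N * K)"
      by (intro mult_left_mono) auto
    then show ?thesis
      by (simp add: norm_mult norm_power mult_ac)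
  qed
  then show "bounded (range (\<lambda>y. (1 + norm y) ^ N *\<^sub>R
      (a * of_real c ^ length is * deriv_list is f (x0 + c *\<^sub>R y))))"
    unfolding bounded_iff by blast
qed

text \<open>\<open>regular_dist\<close> is \<open>undefined\<close> off \<open>Schwartz\<close>, so
  its linearity presupposes that combinations of test functions stay inside.\<close>

lemma Schwartz_lincomb:
  fixes f g :: "real^'n::finite \<Rightarrow> complex"
  assumes f: "f \<in> Schwartz" and g: "g \<in> Schwartz"
  shows "(\<lambda>x. a * f x + b * g x) \<in> Schwartz"
proof -
  have dl: "deriv_list is (\<lambda>x. a * f x + b * g x) = (\<lambda>x. a * deriv_list is f x + b * deriv_list is g x)" for "is"
  proof (induction "is")
    case Nil
    show ?case by (simp add: deriv_list_def)
  next
    case (Cons i js)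
    show ?case
    proof
      fix x
      have "deriv_list js f differentiable (at x)" "deriv_list js g differentiable (at x)"
        using f g unfolding Schwartz_def by auto
      then have D: "(deriv_list js f has_derivative frechet_derivative (deriv_list js f) (at x)) (at x)"
        "(deriv_list js g has_derivative frechet_derivative (deriv_list js g) (at x)) (at x)"
        by (simp_all add: frechet_derivative_works[symmetric])
      have "((\<lambda>x. a * deriv_list js f x + b * deriv_list js g x) has_derivative
          (\<lambda>h. a * frechet_derivative (deriv_list js f) (at x) h + b * frechet_derivative (deriv_list js g) (at x) h)) (at x)"
        by (intro has_derivative_add has_derivative_mult_right D)
      then have "frechet_derivative (\<lambda>x. a * deriv_list js f x + b * deriv_list js g x) (at x) =
          (\<lambda>h. a * frechet_derivative (deriv_list js f) (at x) h + b * frechet_derivative (deriv_list js g) (at x) h)"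
        by (rule frechet_derivative_at[symmetric])
      then show "deriv_list (i # js) (\<lambda>x. a * f x + b * g x) x =
          a * deriv_list (i # js) f x + b * deriv_list (i # js) g x"
        using Cons.IH by (simp add: deriv_list_def partial_deriv_def)
    qed
  qed
  show ?thesis
    unfolding Schwartz_def dl mem_Collect_eq
  proof (intro allI conjI)
    fix "is" x
    show "(\<lambda>x. a * deriv_list is f x + b * deriv_list is g x) differentiable (at x)"
      using f g unfolding Schwartz_def by (intro differentiable_add differentiable_mult differentiable_const) auto
  next
    fix "is" :: "'n list" and N :: nat
    obtain K1 where K1: "\<And>x. (1 + norm x) ^ N * norm (deriv_list is f x) \<le> K1"
      using Schwartz_deriv_bound[OF f] by blast
    obtain K2 where K2: "\<And>x. (1 + norm x) ^ N * norm (deriv_list is g x) \<le> K2"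
      using Schwartz_deriv_bound[OF g] by blast
    have "norm ((1 + norm x) ^ N *\<^sub>R (a * deriv_list is f x + b * deriv_list is g x)) \<le> norm a * K1 + norm b * K2" for x
    proof -
      have "norm ((1 + norm x) ^ N *\<^sub>R (a * deriv_list is f x + b * deriv_list is g x)) \<le>
          (1 + norm x) ^ N * (norm (a * deriv_list is f x) + norm (b * deriv_list is g x))"
        by (simp add: mult_left_mono norm_triangle_ineq)
      also have "\<dots> = norm a * ((1 + norm x) ^ N * norm (deriv_list is f x)) +
          norm b * ((1 + norm x) ^ N * norm (deriv_list is g x))"
        by (simp add: norm_mult algebra_simps)
      also have "\<dots> \<le> norm a * K1 + norm b * K2"
        by (intro add_mono mult_left_mono K1 K2) auto
      finally show ?thesis .
    qed
    then show "bounded (range (\<lambda>x. (1 + norm x) ^ N *\<^sub>R (a * deriv_list is f x + b * deriv_list is g x)))"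
      unfolding bounded_iff by blast
  qed
qed

lemma Schwartz_measurable:
  assumes "f \<in> Schwartz"
  shows "f \<in> borel_measurable borel"
proof -
  have "deriv_list [] f differentiable (at x)" for x
    using assms unfolding Schwartz_def by auto
  then have "continuous_on UNIV f"
    by (auto simp: deriv_list_def intro!: continuous_at_imp_continuous_on differentiable_imp_continuous_within)
  then show ?thesis
    by (rule borel_measurable_continuous_onI)
qed

section \<open>Integrals of product type and decay\<close>

text \<open>The product formula over \<open>Basis\<close>, reindexed along \<open>axis i 1\<close>;
  the integrals over boxes and strips below rest on it.\<close>

lemma nn_integral_vec_prod:
  fixes g :: "'n::finite \<Rightarrow> real \<Rightarrow> ennreal"
  assumes "\<And>i. g i \<in> borel_measurable borel"
  shows "(\<integral>\<^sup>+x. (\<Prod>i\<in>UNIV. g i (x $ i)) \<partial>lborel) = (\<Prod>i\<in>UNIV. \<integral>\<^sup>+t. g i t \<partial>lborel)"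
proof -
  define e :: "'n \<Rightarrow> real^'n" where "e i = axis i 1" for i
  have inj: "inj e" by (auto simp: inj_on_def e_def axis_eq_axis)
  have B: "Basis = range e" by (auto simp: Basis_vec_def e_def)
  have inve: "inv e (e i) = i" for i using inj by simp
  have "(\<integral>\<^sup>+x. (\<Prod>b\<in>Basis. g (inv e b) (x \<bullet> b)) \<partial>lborel) = (\<Prod>b\<in>Basis. \<integral>\<^sup>+t. g (inv e b) t \<partial>lborel)"
    by (rule nn_integral_lborel_prod) (use assms in auto)
  then show ?thesis
    unfolding B prod.reindex[OF inj] o_def inve by (simp add: e_def inner_axis)
qed

text \<open>This is pi times the Cauchy density. Its integral is explicit, and products over the
  coordinates dominate the decay of a Schwartz function while still being integrable factor by
  factor.\<close>

definition bump :: "real \<Rightarrow> real" where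
  "bump t = inverse (1 + t\<^sup>2)"

lemma bump_pos: "0 < bump t"
  unfolding bump_def by (simp add: add_pos_nonneg)

lemma bump_le_1: "bump t \<le> 1"
  unfolding bump_def by (simp add: inverse_le_1_iff)

lemma bump_measurable [measurable]: "bump \<in> borel_measurable borel"
  unfolding bump_def by measurable

lemma bump_bound: "inverse ((1 + \<bar>t\<bar>)\<^sup>2) \<le> bump t"
  unfolding bump_def by (intro le_imp_inverse_le) (auto simp: power2_eq_square algebra_simps add_pos_nonneg)

lemma nn_integral_bump: "(\<integral>\<^sup>+t. ennreal (bump t) \<partial>lborel) = ennreal pi"
proof -
  have "integrable lborel bump"
    using integrable_inverse_1_plus_square by (simp add: set_integrable_def bump_def[abs_def])
  moreover have "(LINT t|lborel. bump t) = pi"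
    using LBINT_inverse_1_plus_square
    by (simp add: interval_lebesgue_integral_def set_lebesgue_integral_def bump_def)
  ultimately show ?thesis
    using bump_pos by (subst nn_integral_eq_integral) (auto simp: less_imp_le)
qed

text \<open>Each coordinate takes two of the 2 n powers, since its absolute value is at most norm
  x.\<close>

lemma prod_bump_bound:
  fixes x :: "real^'n::finite"
  shows "inverse ((1 + norm x) ^ (2 * CARD('n))) \<le> (\<Prod>i\<in>UNIV. bump (x $ i))"
proof -
  have "inverse ((1 + norm x) ^ (2 * CARD('n))) = (\<Prod>i\<in>(UNIV::'n set). inverse ((1 + norm x)\<^sup>2))"
    by (simp add: power_mult power_inverse)
  also have "\<dots> \<le> (\<Prod>i\<in>UNIV. bump (x $ i))"
  proof (intro prod_mono conjI)
    fix i
    have "inverse ((1 + norm x)\<^sup>2) \<le> inverse ((1 + \<bar>x $ i\<bar>)\<^sup>2)"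
      using component_le_norm_cart[of x i]
      by (intro le_imp_inverse_le power_mono zero_less_power) auto
    then show "inverse ((1 + norm x)\<^sup>2) \<le> bump (x $ i)"
      using bump_bound order_trans by blast
  qed simp
  finally show ?thesis .
qed

lemma integrable_prod_bump: "integrable lborel (\<lambda>x::real^'n::finite. \<Prod>i\<in>UNIV. bump (x $ i))"
proof (rule integrableI_bounded)
  have "(\<integral>\<^sup>+x. ennreal (norm (\<Prod>i\<in>UNIV. bump (x $ i))) \<partial>(lborel :: (real^'n) measure))
      = (\<integral>\<^sup>+x. (\<Prod>i\<in>UNIV. ennreal (bump (x $ i))) \<partial>(lborel :: (real^'n) measure))"
    using bump_pos by (simp add: prod_ennreal less_imp_le prod_nonneg abs_prod)
  also have "\<dots> = ennreal pi ^ CARD('n)"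
    by (subst nn_integral_vec_prod) (auto simp: nn_integral_bump)
  also have "\<dots> < \<infinity>"
    by (simp add: ennreal_power)
  finally show "(\<integral>\<^sup>+x. ennreal (norm (\<Prod>i\<in>UNIV. bump (x $ i))) \<partial>(lborel :: (real^'n) measure)) < \<infinity>" .
qed auto

lemma integrable_decay:
  "integrable lborel (\<lambda>x::real^'n::finite. inverse ((1 + norm x) ^ (2 * CARD('n))))"
proof (rule Bochner_Integration.integrable_bound[OF integrable_prod_bump])
  show "AE x::real^'n in lborel. norm (inverse ((1 + norm x) ^ (2 * CARD('n)))) \<le> norm (\<Prod>i\<in>UNIV. bump (x $ i))"
    using prod_bump_bound bump_pos by (auto simp: abs_prod less_imp_le)
qed auto

section \<open>Regular distributions and convolutions\<close>

lemma Schwartz_bound: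
  fixes f :: "real^'n::finite \<Rightarrow> complex"
  assumes "f \<in> Schwartz"
  obtains K where "K \<ge> 0" "\<And>x. norm (f x) \<le> K * inverse ((1 + norm x) ^ N)"
proof -
  obtain K where K: "\<And>x. (1 + norm x) ^ N * norm (deriv_list [] f x) \<le> K"
    using Schwartz_deriv_bound[OF assms] by blast
  have pos: "0 < (1 + norm x) ^ N" for x :: "real^'n"
    by (simp add: add_pos_nonneg)
  have "norm (f x) \<le> K * inverse ((1 + norm x) ^ N)" for x
    using K[of x] pos[of x] by (simp add: deriv_list_def field_simps)
  moreover have "0 \<le> K"
    using K[of 0] by (meson mult_nonneg_nonneg norm_ge_zero order_trans pos less_imp_le)
  ultimately show thesis using that by blast
qed

text \<open>The bound is linear in K. With f a difference of test functions and K its seminorm, it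
  gives the continuity of regular distributions.\<close>

lemma Schwartz_bounded_mult_bound:
  fixes f g :: "real^'n::finite \<Rightarrow> complex"
  assumes g: "g \<in> borel_measurable borel" "\<And>x. norm (g x) \<le> B"
    and f: "f \<in> borel_measurable borel" "\<And>x. norm (f x) \<le> K * inverse ((1 + norm x) ^ (2 * CARD('n)))"
  shows "integrable lborel (\<lambda>x. g x * f x)"
    and "norm (LINT x|lborel. g x * f x) \<le>
      B * K * (LINT x|(lborel :: (real^'n) measure). inverse ((1 + norm x) ^ (2 * CARD('n))))"
proof -
  have B: "0 \<le> B" using g(2)[of 0] norm_ge_zero order_trans by blast
  have b: "norm (g x * f x) \<le> B * K * inverse ((1 + norm x) ^ (2 * CARD('n)))" for x
    using mult_mono[OF g(2)[of x] f(2)[of x]] B by (simp add: norm_mult mult_ac)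
  have i: "integrable lborel (\<lambda>x::real^'n. B * K * inverse ((1 + norm x) ^ (2 * CARD('n))))"
    by (intro integrable_mult_right integrable_decay)
  show int: "integrable lborel (\<lambda>x. g x * f x)"
    by (rule Bochner_Integration.integrable_bound[OF i]) (use b f(1) g(1) order_trans[OF _ abs_ge_self] in auto)
  have "norm (LINT x|lborel. g x * f x) \<le> (LINT x|(lborel::(real^'n) measure). B * K * inverse ((1 + norm x) ^ (2 * CARD('n))))"
    by (rule Bochner_Integration.integral_norm_bound_integral[OF int i]) (use b in auto)
  then show "norm (LINT x|lborel. g x * f x) \<le>
      B * K * (LINT x|(lborel :: (real^'n) measure). inverse ((1 + norm x) ^ (2 * CARD('n))))"
    by simp
qed

lemma integrable_bounded_mult_Schwartz:
  fixes f g :: "real^'n::finite \<Rightarrow> complex"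
  assumes "g \<in> borel_measurable borel" "\<And>x. norm (g x) \<le> B" "f \<in> Schwartz"
  shows "integrable lborel (\<lambda>x. g x * f x)"
proof -
  obtain K where "\<And>x. norm (f x) \<le> K * inverse ((1 + norm x) ^ (2 * CARD('n)))"
    using Schwartz_bound[OF assms(3)] by blast
  then show ?thesis
    by (intro Schwartz_bounded_mult_bound(1)[OF assms(1,2)] Schwartz_measurable[OF assms(3)])
qed

text \<open>A single seminorm, without derivatives and of order 2 n, controls the functional; hence
  the preimage of a ball contains a basic neighbourhood of each of its points.\<close>

lemma regular_dist_tempered:
  fixes g :: "real^'n::finite \<Rightarrow> complex"
  assumes g: "g \<in> borel_measurable borel" "\<And>x. norm (g x) \<le> B"
  shows "regular_dist g \<in> tempered_distributions"
proof -
  let ?T = "regular_dist g" and ?N = "2 * CARD('n)"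
  have int: "integrable lborel (\<lambda>x. g x * \<psi> x)" if "\<psi> \<in> Schwartz" for \<psi>
    using integrable_bounded_mult_Schwartz[OF g that] .
  have lin: "?T (\<lambda>x. a * \<psi> x + b * \<eta> x) = a * ?T \<psi> + b * ?T \<eta>"
    if "\<psi> \<in> Schwartz" "\<eta> \<in> Schwartz" for \<psi> \<eta> a b
  proof -
    have "?T (\<lambda>x. a * \<psi> x + b * \<eta> x) = (LINT x|lborel. a * (g x * \<psi> x) + b * (g x * \<eta> x))"
      using Schwartz_lincomb[OF that] by (simp add: regular_dist_def algebra_simps)
    also have "\<dots> = a * ?T \<psi> + b * ?T \<eta>"
      using that int by (simp add: regular_dist_def)
    finally show ?thesis .
  qed
  define C where "C = B * (LINT x|(lborel :: (real^'n) measure). inverse ((1 + norm x) ^ ?N))"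
  have C: "0 \<le> C"
    unfolding C_def using order_trans[OF norm_ge_zero g(2)] by (intro mult_nonneg_nonneg integral_nonneg_AE) auto
  have diff: "norm (?T \<psi> - ?T \<eta>) \<le> C * Schwartz_seminorm ?N [] (\<lambda>x. \<psi> x - \<eta> x)"
    if S: "\<psi> \<in> Schwartz" "\<eta> \<in> Schwartz" for \<psi> \<eta>
  proof -
    let ?S = "Schwartz_seminorm ?N [] (\<lambda>x. \<psi> x - \<eta> x)"
    obtain K1 where K1: "\<And>x. (1 + norm x) ^ ?N * norm (deriv_list [] \<psi> x) \<le> K1"
      using Schwartz_deriv_bound[OF S(1)] by blast
    obtain K2 where K2: "\<And>x. (1 + norm x) ^ ?N * norm (deriv_list [] \<eta> x) \<le> K2"
      using Schwartz_deriv_bound[OF S(2)] by blast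
    have "(1 + norm x) ^ ?N * norm (\<psi> x - \<eta> x) \<le> K1 + K2" for x
    proof -
      have "(1 + norm x) ^ ?N * norm (\<psi> x - \<eta> x) \<le> (1 + norm x) ^ ?N * (norm (\<psi> x) + norm (\<eta> x))"
        by (intro mult_left_mono norm_triangle_ineq4) auto
      then show ?thesis
        using K1[of x] K2[of x] by (simp add: deriv_list_def algebra_simps)
    qed
    \<comment> \<open>\<open>Schwartz_seminorm\<close> is a real supremum, so it is an upper bound
      only once its range is known to be bounded above.\<close>
    then have "bdd_above (range (\<lambda>x. (1 + norm x) ^ ?N * norm (\<psi> x - \<eta> x)))"
      by (auto simp: bdd_above_def)
    then have le: "(1 + norm x) ^ ?N * norm (\<psi> x - \<eta> x) \<le> ?S" for x
      by (auto simp: Schwartz_seminorm_def deriv_list_def intro: cSUP_upper)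
    have "norm (\<psi> x - \<eta> x) \<le> ?S * inverse ((1 + norm x) ^ ?N)" for x
    proof -
      have "0 < (1 + norm x) ^ ?N" by (simp add: add_pos_nonneg)
      then show ?thesis using le[of x] by (simp add: field_simps)
    qed
    then have "norm (LINT x|lborel. g x * (\<psi> x - \<eta> x)) \<le> C * ?S"
      using Schwartz_bounded_mult_bound(2)[OF g, of "\<lambda>x. \<psi> x - \<eta> x" ?S] Schwartz_measurable[OF S(1)]
        Schwartz_measurable[OF S(2)] by (simp add: C_def mult_ac)
    also have "(LINT x|lborel. g x * (\<psi> x - \<eta> x)) = ?T \<psi> - ?T \<eta>"
      using S int by (simp add: regular_dist_def right_diff_distrib)
    finally show ?thesis .
  qed
  have nbhd: "openin Schwartz_topology {\<eta> \<in> Schwartz. Schwartz_seminorm N is (\<lambda>x. \<eta> x - \<psi> x) < r}"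
    if "\<psi> \<in> Schwartz" "r > 0" for N "is" r and \<psi> :: "real^'n \<Rightarrow> complex"
    unfolding Schwartz_topology_def using that
    by (intro topology_generated_by_Basis) blast
  have top: "topspace (Schwartz_topology :: (real^'n \<Rightarrow> complex) topology) \<subseteq> Schwartz"
    unfolding Schwartz_topology_def topology_generated_by_topspace by auto
  have "continuous_map Schwartz_topology euclidean ?T"
    unfolding continuous_map_def
  proof (intro conjI allI impI)
    fix U :: "complex set" assume "openin euclidean U"
    then have U: "open U" by simp
    show "openin Schwartz_topology {x \<in> topspace Schwartz_topology. ?T x \<in> U}"
    proof (subst openin_subopen, intro ballI)
      fix \<psi> assume "\<psi> \<in> {x \<in> topspace Schwartz_topology. ?T x \<in> U}"
      then have \<psi>: "\<psi> \<in> Schwartz" "?T \<psi> \<in> U" using top by auto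
      obtain e where e: "e > 0" "ball (?T \<psi>) e \<subseteq> U"
        using U \<psi>(2) openE by blast
      \<comment> \<open>C + 1 in place of C, since C may vanish.\<close>
      define r where "r = e / (C + 1)"
      have r: "r > 0" using e C by (simp add: r_def)
      let ?V = "{\<eta> \<in> Schwartz. Schwartz_seminorm ?N [] (\<lambda>x. \<eta> x - \<psi> x) < r}"
      have "openin Schwartz_topology ?V" by (rule nbhd[OF \<psi>(1) r])
      moreover have "\<psi> \<in> ?V"
        using \<psi>(1) r by (simp add: Schwartz_seminorm_def deriv_list_def)
      moreover have "?V \<subseteq> {x \<in> topspace Schwartz_topology. ?T x \<in> U}"
      proof
        fix \<eta> assume \<eta>: "\<eta> \<in> ?V"
        have "norm (?T \<eta> - ?T \<psi>) \<le> C * Schwartz_seminorm ?N [] (\<lambda>x. \<eta> x - \<psi> x)"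
          using \<eta> \<psi>(1) by (intro diff) auto
        also have "\<dots> \<le> C * r" using \<eta> C by (intro mult_left_mono) auto
        also have "\<dots> < e" using e C by (simp add: r_def field_simps)
        finally have "?T \<eta> \<in> U"
          using e(2) by (auto simp: dist_norm norm_minus_commute subset_iff)
        moreover have "\<eta> \<in> topspace Schwartz_topology"
          using openin_subset[OF nbhd[OF \<psi>(1) r]] \<eta> by blast
        ultimately show "\<eta> \<in> {x \<in> topspace Schwartz_topology. ?T x \<in> U}" by simp
      qed
      ultimately show "\<exists>V. openin Schwartz_topology V \<and> \<psi> \<in> V \<and>
          V \<subseteq> {x \<in> topspace Schwartz_topology. ?T x \<in> U}" by blast
    qed
  qed auto
  moreover have "?T \<in> extensional Schwartz"
    by (simp add: regular_dist_def)
  ultimately show ?thesis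
    unfolding tempered_distributions_def by (simp add: lin)
qed

lemma lborel_integral_affine:
  fixes F :: "real^'n::finite \<Rightarrow> complex"
  assumes [measurable]: "F \<in> borel_measurable borel" and "c \<noteq> 0"
  shows "(LINT y|lborel. F y) = \<bar>c\<bar> ^ CARD('n) *\<^sub>R (LINT v|lborel. F (t + c *\<^sub>R v))"
proof -
  have "(LINT y|lborel. F y) =
      (LINT y|density (distr lborel borel (\<lambda>v. t + c *\<^sub>R v)) (\<lambda>_. ennreal (\<bar>c\<bar> ^ DIM(real^'n))). F y)"
    using lborel_affine[OF assms(2), of t] by simp
  also have "\<dots> = \<bar>c\<bar> ^ CARD('n) *\<^sub>R (LINT v|lborel. F (t + c *\<^sub>R v))"
    by (subst integral_density, simp_all add: integral_distr)
  finally show ?thesis .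
qed

text \<open>With \<open>mother\<close>, the case \<open>j = 0\<close> of \<open>phi_seq\<close> has the same form as the others: every
  \<open>phi_seq\<close> is the \<open>L\<^sup>1\<close>-normalised dilation of a Schwartz function by \<open>2\<^sup>j\<close>.\<close>

definition mother ::
  "(real^'n::finite \<Rightarrow> complex) \<Rightarrow> (real^'n \<Rightarrow> complex) \<Rightarrow> nat \<Rightarrow> real^'n \<Rightarrow> complex" where
  "mother \<phi>0 \<phi> j = (if j = 0 then \<phi>0 else \<phi>)"

lemma phi_seq_mother: "phi_seq \<phi>0 (\<phi> :: real^'n::finite \<Rightarrow> complex) j x =
    2 ^ (j * CARD('n)) * mother \<phi>0 \<phi> j (2 ^ j *\<^sub>R x)"
  by (simp add: phi_seq_def mother_def)

text \<open>Substituting y = x - 2^(-j) v moves the dilation from the kernel to f. Every scale is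
  then integrated against one of the two fixed functions \<open>\<phi>0\<close> and
  \<open>\<phi>\<close>, which makes estimates uniform in j possible.\<close>

lemma convolution_regular_dist:
  fixes f :: "real^'n::finite \<Rightarrow> complex"
  assumes \<phi>: "\<phi>0 \<in> Schwartz" "\<phi> \<in> Schwartz" and f: "f \<in> borel_measurable borel"
  shows "convolution_dist (phi_seq \<phi>0 \<phi> j) (regular_dist f) x =
    (LINT v|lborel. f (x - (1 / 2 ^ j) *\<^sub>R v) * mother \<phi>0 \<phi> j v)"
proof -
  let ?m = "mother \<phi>0 \<phi> j"
  have m: "?m \<in> Schwartz" using \<phi> by (simp add: mother_def)
  note [measurable] = Schwartz_measurable[OF m] f
  have eq: "phi_seq \<phi>0 \<phi> j (x - y) = 2 ^ (j * CARD('n)) * ?m (2 ^ j *\<^sub>R x + (- (2 ^ j)) *\<^sub>R y)" for y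
    by (simp add: phi_seq_mother scaleR_diff_right)
  have "(\<lambda>y. phi_seq \<phi>0 \<phi> j (x - y)) \<in> Schwartz"
    unfolding eq by (rule Schwartz_affine[OF m]) simp
  then have "convolution_dist (phi_seq \<phi>0 \<phi> j) (regular_dist f) x =
      (LINT y|lborel. f y * (2 ^ (j * CARD('n)) * ?m (2 ^ j *\<^sub>R x + (- (2 ^ j)) *\<^sub>R y)))"
    by (simp add: convolution_dist_def regular_dist_def eq)
  also have "\<dots> = \<bar>- (1 / 2 ^ j)\<bar> ^ CARD('n) *\<^sub>R (LINT v|lborel. f (x + (- (1 / 2 ^ j)) *\<^sub>R v) *
      (2 ^ (j * CARD('n)) * ?m (2 ^ j *\<^sub>R x + (- (2 ^ j)) *\<^sub>R (x + (- (1 / 2 ^ j)) *\<^sub>R v))))"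
    by (rule lborel_integral_affine) auto
  also have "(\<lambda>v. 2 ^ j *\<^sub>R x + (- (2 ^ j)) *\<^sub>R (x + (- (1 / 2 ^ j)) *\<^sub>R v)) = (\<lambda>v. v)"
    by (simp add: algebra_simps)
  then have "(\<lambda>v. f (x + (- (1 / 2 ^ j)) *\<^sub>R v) *
      (2 ^ (j * CARD('n)) * ?m (2 ^ j *\<^sub>R x + (- (2 ^ j)) *\<^sub>R (x + (- (1 / 2 ^ j)) *\<^sub>R v)))) =
      (\<lambda>v. 2 ^ (j * CARD('n)) * (f (x - (1 / 2 ^ j) *\<^sub>R v) * ?m v))"
    by (simp add: fun_eq_iff)
  also have "\<bar>- (1 / 2 ^ j)\<bar> ^ CARD('n) *\<^sub>R (LINT v|lborel. 2 ^ (j * CARD('n)) * (f (x - (1 / 2 ^ j) *\<^sub>R v) * ?m v))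
      = (LINT v|lborel. f (x - (1 / 2 ^ j) *\<^sub>R v) * ?m v)"
    by (simp add: power_mult power_one_over scaleR_conv_of_real)
  finally show ?thesis .
qed

lemma convolution_measurable:
  fixes f :: "real^'n::finite \<Rightarrow> complex"
  assumes \<phi>: "\<phi>0 \<in> Schwartz" "\<phi> \<in> Schwartz" and f: "f \<in> borel_measurable borel"
  shows "convolution_dist (phi_seq \<phi>0 \<phi> j) (regular_dist f) \<in> borel_measurable borel"
proof -
  have m: "mother \<phi>0 \<phi> j \<in> Schwartz" using \<phi> by (simp add: mother_def)
  note [measurable] = Schwartz_measurable[OF m] f
  have "(\<lambda>x. LINT v|lborel. f (x - (1 / 2 ^ j) *\<^sub>R v) * mother \<phi>0 \<phi> j v) \<in> borel_measurable borel"
    by measurable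
  then show ?thesis
    by (simp add: convolution_regular_dist[OF assms, abs_def])
qed

section \<open>Localisation and cancellation\<close>

text \<open>Where g and h agree nothing is left, and outside the ball of radius r the decay of
  \<open>\<psi>\<close> gains (1 + r)^(-N). The constant is fixed before g, h, B and r. In the
  applications h is 0 (decay at infinity), a constant (cancellation) or a multiple of a half-space
  indicator (the jump).\<close>

lemma integral_diff_tail:
  fixes \<psi> :: "real^'n::finite \<Rightarrow> complex"
  assumes \<psi>: "\<psi> \<in> Schwartz"
  obtains C where "C \<ge> 0"
    and "\<And>g h B r. \<lbrakk>g \<in> borel_measurable borel; h \<in> borel_measurable borel; \<And>v. norm (g v) \<le> B;
      \<And>v. norm (h v) \<le> B; 0 \<le> r; \<And>v. norm v < r \<Longrightarrow> g v = h v\<rbrakk> \<Longrightarrow>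
      norm ((LINT v|lborel. g v * \<psi> v) - (LINT v|lborel. h v * \<psi> v)) \<le> C * B * inverse ((1 + r) ^ N)"
proof -
  \<comment> \<open>N powers give the gain in r, the other 2 n keep the tail integrable.\<close>
  obtain K where K: "K \<ge> 0" "\<And>x. norm (\<psi> x) \<le> K * inverse ((1 + norm x) ^ (N + 2 * CARD('n)))"
    using Schwartz_bound[OF \<psi>, of "N + 2 * CARD('n)"] by blast
  define I where "I = (LINT x|(lborel :: (real^'n) measure). inverse ((1 + norm x) ^ (2 * CARD('n))))"
  have I: "0 \<le> I" unfolding I_def by (intro integral_nonneg_AE) auto
  have "norm ((LINT v|lborel. g v * \<psi> v) - (LINT v|lborel. h v * \<psi> v)) \<le> (2 * K * I) * B * inverse ((1 + r) ^ N)"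
    if g: "g \<in> borel_measurable borel" "\<And>v. norm (g v) \<le> B"
      and h: "h \<in> borel_measurable borel" "\<And>v. norm (h v) \<le> B"
      and r: "0 \<le> r" "\<And>v. norm v < r \<Longrightarrow> g v = h v" for g h B r
  proof -
    have B: "0 \<le> B" using order_trans[OF norm_ge_zero g(2)] .
    define c where "c = (2 * B) * (K * inverse ((1 + r) ^ N))"
    have c: "0 \<le> c" using B K r by (simp add: c_def)
    have int: "integrable lborel (\<lambda>v. g v * \<psi> v)" "integrable lborel (\<lambda>v. h v * \<psi> v)"
      using integrable_bounded_mult_Schwartz[OF g \<psi>] integrable_bounded_mult_Schwartz[OF h \<psi>] .
    have "(LINT v|lborel. g v * \<psi> v) - (LINT v|lborel. h v * \<psi> v) = (LINT v|lborel. g v * \<psi> v - h v * \<psi> v)"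
      using int by simp
    also have "norm \<dots> \<le> (LINT v|(lborel::(real^'n) measure). c * inverse ((1 + norm v) ^ (2 * CARD('n))))"
    proof (rule Bochner_Integration.integral_norm_bound_integral)
      show "integrable lborel (\<lambda>v. g v * \<psi> v - h v * \<psi> v)" using int by auto
      show "integrable lborel (\<lambda>v::real^'n. c * inverse ((1 + norm v) ^ (2 * CARD('n))))"
        by (intro integrable_mult_right integrable_decay)
      fix v :: "real^'n"
      show "norm (g v * \<psi> v - h v * \<psi> v) \<le> c * inverse ((1 + norm v) ^ (2 * CARD('n)))"
      proof (cases "norm v < r")
        case True
        then show ?thesis using r(2) c by simp
      next
        case False
        have "norm (g v - h v) \<le> 2 * B"
          using norm_triangle_ineq4[of "g v" "h v"] g(2)[of v] h(2)[of v] by simp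
        moreover have "norm (\<psi> v) \<le> K * (inverse ((1 + r) ^ N) * inverse ((1 + norm v) ^ (2 * CARD('n))))"
        proof -
          have "norm (\<psi> v) \<le> K * (inverse ((1 + norm v) ^ N) * inverse ((1 + norm v) ^ (2 * CARD('n))))"
            using K(2)[of v] by (simp add: power_add)
          also have "\<dots> \<le> K * (inverse ((1 + r) ^ N) * inverse ((1 + norm v) ^ (2 * CARD('n))))"
            using False r K(1) by (intro mult_left_mono mult_right_mono le_imp_inverse_le power_mono) auto
          finally show ?thesis .
        qed
        ultimately have "norm (g v - h v) * norm (\<psi> v) \<le>
            2 * B * (K * (inverse ((1 + r) ^ N) * inverse ((1 + norm v) ^ (2 * CARD('n)))))"
          using B by (intro mult_mono) auto
        moreover have "g v * \<psi> v - h v * \<psi> v = (g v - h v) * \<psi> v"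
          by (simp add: left_diff_distrib)
        ultimately show ?thesis
          by (simp add: c_def norm_mult mult_ac)
      qed
    qed
    also have "\<dots> = c * I" by (simp add: I_def)
    finally show ?thesis by (simp add: c_def mult_ac)
  qed
  moreover have "0 \<le> 2 * K * I" using K I by simp
  ultimately show thesis using that by blast
qed

lemma Schwartz_integrable: "f \<in> Schwartz \<Longrightarrow> integrable lborel f"
  using integrable_bounded_mult_Schwartz[of "\<lambda>_. 1" 1 f] by simp

text \<open>The integral is a nonzero multiple of the Fourier transform at 0, and 0 lies outside the
  annulus that carries this transform.\<close>

lemma admissible_integral_zero:
  assumes "admissible_pair \<phi>0 \<phi>"
  shows "(LINT v|lborel. \<phi> v) = 0"
proof -
  have "support (fourier \<phi>) \<subseteq> {\<xi>. 1/2 \<le> norm \<xi> \<and> norm \<xi> \<le> 2}"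
    using assms by (auto simp: admissible_pair_def)
  then have "0 \<notin> support (fourier \<phi>)" by auto
  then have "fourier \<phi> 0 = 0"
    using closure_subset[of "{x. fourier \<phi> x \<noteq> 0}"] by (auto simp: support_def)
  then show ?thesis by (simp add: fourier_def)
qed

section \<open>Convolution with a half-space\<close>

text \<open>The law of the i-th coordinate under the density w. Positive measures on the line are
  used because their distribution functions determine them; the complex function
  \<open>\<phi>\<close> enters through four nonnegative densities.\<close>

definition marginal :: "'n::finite \<Rightarrow> (real^'n \<Rightarrow> real) \<Rightarrow> real measure" where
  "marginal i w = distr (density lborel (\<lambda>v. ennreal (w v))) borel (\<lambda>v. v $ i)"

lemma marginal_integral:
  fixes e :: "real \<Rightarrow> 'b::{banach, second_countable_topology}"
  assumes [measurable]: "w \<in> borel_measurable borel" "e \<in> borel_measurable borel" and "\<And>v. 0 \<le> w v"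
  shows "(LINT t|marginal i w. e t) = (LINT v|lborel. w v *\<^sub>R e (v $ i))"
  unfolding marginal_def using assms(3)
  by (subst integral_distr, simp_all, subst integral_density, simp_all)

lemma marginal_finite_borel:
  assumes "integrable lborel w" "\<And>v. 0 \<le> w v"
  shows "finite_borel_measure (marginal i w)"
proof -
  note [measurable] = borel_measurable_integrable[OF assms(1)]
  have "emeasure (marginal i w) UNIV = (\<integral>\<^sup>+v. ennreal (w v) \<partial>lborel)"
    unfolding marginal_def by (subst emeasure_distr) (simp_all add: emeasure_density)
  also have "\<dots> < \<infinity>"
    using assms by (subst nn_integral_eq_integral) auto
  finally have "emeasure (marginal i w) (space (marginal i w)) \<noteq> \<infinity>"
    by (simp add: marginal_def)
  then show ?thesis
    by (intro finite_borel_measure.intro finite_measureI finite_borel_measure_axioms.intro) (auto simp: marginal_def)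
qed

lemma marginal_cdf:
  assumes "integrable lborel w" "\<And>v. 0 \<le> w v"
  shows "cdf (marginal i w) t = (LINT v|lborel. w v * indicator {..t} (v $ i))"
proof -
  interpret finite_borel_measure "marginal i w" by (rule marginal_finite_borel[OF assms])
  have "cdf (marginal i w) t = (LINT s|marginal i w. indicator {..t} s)"
    by (simp add: cdf_def marginal_def)
  also have "\<dots> = (LINT v|lborel. w v *\<^sub>R indicator {..t} (v $ i))"
    using assms by (intro marginal_integral) auto
  finally show ?thesis by simp
qed

text \<open>The convolution of \<open>\<phi>\<^sub>j\<close> with the indicator of the half-space \<open>x\<^sub>i \<ge> 0\<close> is
  \<open>cumulative i \<phi> (2\<^sup>j x\<^sub>i)\<close>.\<close>

definition cumulative :: "'n::finite \<Rightarrow> (real^'n \<Rightarrow> complex) \<Rightarrow> real \<Rightarrow> complex" where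
  "cumulative i \<phi> t = (LINT v|lborel. indicator {..t} (v $ i) * \<phi> v)"

lemma integrable_pos_neg_parts:
  fixes \<phi> :: "real^'n::finite \<Rightarrow> complex"
  assumes "integrable lborel \<phi>"
  shows "integrable lborel (\<lambda>v. max 0 (Re (\<phi> v)))" "integrable lborel (\<lambda>v. max 0 (- Re (\<phi> v)))"
    "integrable lborel (\<lambda>v. max 0 (Im (\<phi> v)))" "integrable lborel (\<lambda>v. max 0 (- Im (\<phi> v)))"
  using assms
  by (intro Bochner_Integration.integrable_max integrable_minus integrable_zero integrable_Re integrable_Im; simp)+

text \<open>If e depends on \<open>v $ i\<close> only, each term is an integral against a marginal.
  Applied to half-line indicators and to exponentials, this links distribution functions with the
  Fourier transform on an axis.\<close>

lemma integral_pos_neg_parts: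
  fixes \<phi> :: "real^'n::finite \<Rightarrow> complex" and e :: "real^'n \<Rightarrow> complex"
  assumes \<phi>: "integrable lborel \<phi>" and e: "e \<in> borel_measurable borel" "\<And>v. norm (e v) \<le> B"
  shows "(LINT v|lborel. e v * \<phi> v) =
    ((LINT v|lborel. max 0 (Re (\<phi> v)) *\<^sub>R e v) - (LINT v|lborel. max 0 (- Re (\<phi> v)) *\<^sub>R e v)) +
    \<i> * ((LINT v|lborel. max 0 (Im (\<phi> v)) *\<^sub>R e v) - (LINT v|lborel. max 0 (- Im (\<phi> v)) *\<^sub>R e v))"
proof -
  note [measurable] = borel_measurable_integrable[OF \<phi>] e(1)
  have B: "0 \<le> B" using order_trans[OF norm_ge_zero e(2)] .
  have *: "integrable lborel (\<lambda>v. w v *\<^sub>R e v)"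
    if [measurable]: "w \<in> borel_measurable borel" and "\<And>v. \<bar>w v\<bar> \<le> norm (\<phi> v)" for w
  proof (rule Bochner_Integration.integrable_bound[OF integrable_mult_right[OF integrable_norm[OF \<phi>], of B]])
    show "AE v in lborel. norm (w v *\<^sub>R e v) \<le> norm (B * norm (\<phi> v))"
      using mult_mono[OF that(2) e(2)] B by (auto simp: mult_ac)
  qed auto
  have bnd: "\<bar>max 0 (Re z)\<bar> \<le> norm z" "\<bar>max 0 (- Re z)\<bar> \<le> norm z"
    "\<bar>max 0 (Im z)\<bar> \<le> norm z" "\<bar>max 0 (- Im z)\<bar> \<le> norm z" for z
    using abs_Re_le_cmod[of z] abs_Im_le_cmod[of z] by (auto simp: max_def)
  have i: "integrable lborel (\<lambda>v. max 0 (Re (\<phi> v)) *\<^sub>R e v)" "integrable lborel (\<lambda>v. max 0 (- Re (\<phi> v)) *\<^sub>R e v)"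
    "integrable lborel (\<lambda>v. max 0 (Im (\<phi> v)) *\<^sub>R e v)" "integrable lborel (\<lambda>v. max 0 (- Im (\<phi> v)) *\<^sub>R e v)"
    by (rule *, measurable, rule bnd)+
  have "e v * \<phi> v = (max 0 (Re (\<phi> v)) *\<^sub>R e v - max 0 (- Re (\<phi> v)) *\<^sub>R e v) +
      \<i> * (max 0 (Im (\<phi> v)) *\<^sub>R e v - max 0 (- Im (\<phi> v)) *\<^sub>R e v)" for v
    by (auto simp: complex_eq_iff max_def)
  then have "(LINT v|lborel. e v * \<phi> v) =
      (LINT v|lborel. (max 0 (Re (\<phi> v)) *\<^sub>R e v - max 0 (- Re (\<phi> v)) *\<^sub>R e v) +
      \<i> * (max 0 (Im (\<phi> v)) *\<^sub>R e v - max 0 (- Im (\<phi> v)) *\<^sub>R e v))"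
    by simp
  also have "\<dots> = ((LINT v|lborel. max 0 (Re (\<phi> v)) *\<^sub>R e v) - (LINT v|lborel. max 0 (- Re (\<phi> v)) *\<^sub>R e v)) +
    \<i> * ((LINT v|lborel. max 0 (Im (\<phi> v)) *\<^sub>R e v) - (LINT v|lborel. max 0 (- Im (\<phi> v)) *\<^sub>R e v))"
    using i by simp
  finally show ?thesis .
qed

lemma cumulative_cdf:
  fixes \<phi> :: "real^'n::finite \<Rightarrow> complex"
  assumes \<phi>: "integrable lborel \<phi>"
  shows "cumulative i \<phi> t =
    Complex (cdf (marginal i (\<lambda>v. max 0 (Re (\<phi> v)))) t - cdf (marginal i (\<lambda>v. max 0 (- Re (\<phi> v)))) t)
      (cdf (marginal i (\<lambda>v. max 0 (Im (\<phi> v)))) t - cdf (marginal i (\<lambda>v. max 0 (- Im (\<phi> v)))) t)"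
proof -
  have *: "(LINT v|lborel. w v *\<^sub>R (indicator {..t} (v $ i) :: complex)) = of_real (cdf (marginal i w) t)"
    if "integrable lborel w" "\<And>v. 0 \<le> w v" for w
  proof -
    have "(LINT v|lborel. w v *\<^sub>R (indicator {..t} (v $ i) :: complex)) =
        (LINT v|lborel. complex_of_real (w v * indicator {..t} (v $ i)))"
      by (intro Bochner_Integration.integral_cong) (auto simp: indicator_def scaleR_conv_of_real)
    then show ?thesis by (simp only: integral_complex_of_real marginal_cdf[OF that])
  qed
  note i = integrable_pos_neg_parts[OF \<phi>]
  have e: "norm (indicator {..t} (v $ i) :: complex) \<le> 1" for v :: "real^'n"
    by (auto simp: indicator_def)
  have m: "(\<lambda>v::real^'n. indicator {..t} (v $ i) :: complex) \<in> borel_measurable borel"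
    by measurable
  show ?thesis
    unfolding cumulative_def integral_pos_neg_parts[OF \<phi> m e]
    by (simp add: * i complex_eq_iff)
qed

text \<open>Inherited from distribution functions and used twice: to carry vanishing from t \<noteq>
  0 to t = 0, and to widen one point of nonvanishing to an interval.\<close>

lemma cumulative_right_cont:
  fixes \<phi> :: "real^'n::finite \<Rightarrow> complex"
  assumes \<phi>: "integrable lborel \<phi>"
  shows "(cumulative i \<phi> \<longlongrightarrow> cumulative i \<phi> t) (at_right t)"
proof -
  have *: "(cdf (marginal i w) \<longlongrightarrow> cdf (marginal i w) t) (at_right t)"
    if "integrable lborel w" "\<And>v. 0 \<le> w v" for w
    using finite_borel_measure.cdf_is_right_cont[OF marginal_finite_borel[OF that]]
    by (simp add: continuous_within)
  note i = integrable_pos_neg_parts[OF \<phi>]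
  show ?thesis
    unfolding cumulative_cdf[OF \<phi>, abs_def] tendsto_complex_iff
    by (auto intro!: tendsto_intros * i)
qed

text \<open>Otherwise the marginals of the positive and negative parts of \<open>\<phi>\<close> would have equal distribution
  functions, so the Fourier transform of \<open>\<phi>\<close> would vanish on the \<open>i\<close>-th axis.\<close>

lemma cumulative_nonzero:
  fixes \<phi>0 \<phi> :: "real^'n::finite \<Rightarrow> complex"
  assumes "admissible_pair \<phi>0 \<phi>"
  shows "\<exists>t. t \<noteq> 0 \<and> cumulative i \<phi> t \<noteq> 0"
proof (rule ccontr)
  assume "\<not> ?thesis"
  then have 0: "cumulative i \<phi> t = 0" if "t \<noteq> 0" for t using that by auto
  have \<phi>: "integrable lborel \<phi>"
    using assms Schwartz_integrable by (auto simp: admissible_pair_def)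
  have "eventually (\<lambda>u. cumulative i \<phi> u = 0) (at_right 0)"
    by (auto simp: eventually_at_filter 0)
  with cumulative_right_cont[OF \<phi>, of i 0] have "((\<lambda>_. 0) \<longlongrightarrow> cumulative i \<phi> 0) (at_right (0::real))"
    by (rule Lim_transform_eventually)
  then have "cumulative i \<phi> 0 = 0"
    by (simp add: tendsto_const_iff)
  with 0 have z: "cumulative i \<phi> t = 0" for t by (cases "t = 0") auto
  note i = integrable_pos_neg_parts[OF \<phi>]
  have "marginal i (\<lambda>v. max 0 (Re (\<phi> v))) = marginal i (\<lambda>v. max 0 (- Re (\<phi> v)))"
    by (rule cdf_unique') (use z i in \<open>auto simp: cumulative_cdf[OF \<phi>] complex_eq_iff fun_eq_iff intro!: marginal_finite_borel\<close>)
  moreover have "marginal i (\<lambda>v. max 0 (Im (\<phi> v))) = marginal i (\<lambda>v. max 0 (- Im (\<phi> v)))"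
    by (rule cdf_unique') (use z i in \<open>auto simp: cumulative_cdf[OF \<phi>] complex_eq_iff fun_eq_iff intro!: marginal_finite_borel\<close>)
  moreover note [measurable] = borel_measurable_integrable[OF \<phi>]
  have "(LINT v|lborel. exp (- (\<i> * complex_of_real (v $ i))) * \<phi> v) =
    ((LINT t|marginal i (\<lambda>v. max 0 (Re (\<phi> v))). exp (- (\<i> * complex_of_real t))) -
     (LINT t|marginal i (\<lambda>v. max 0 (- Re (\<phi> v))). exp (- (\<i> * complex_of_real t)))) +
    \<i> * ((LINT t|marginal i (\<lambda>v. max 0 (Im (\<phi> v))). exp (- (\<i> * complex_of_real t))) -
     (LINT t|marginal i (\<lambda>v. max 0 (- Im (\<phi> v))). exp (- (\<i> * complex_of_real t))))"
    by (subst integral_pos_neg_parts[OF \<phi>, where B=1]) (auto simp: marginal_integral)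
  ultimately have "fourier \<phi> (axis i 1) = 0"
    by (simp add: fourier_def inner_axis)
  moreover obtain C where C: "C > 0" "\<And>\<xi>. 3/5 \<le> norm \<xi> \<and> norm \<xi> \<le> 5/3 \<Longrightarrow> norm (fourier \<phi> \<xi>) \<ge> C"
    using assms by (auto simp: admissible_pair_def)
  \<comment> \<open>The vector \<open>axis i 1\<close> has norm 1, which lies between 3/5 and 5/3,
    where the transform is bounded away from 0.\<close>
  ultimately show False using C(2)[of "axis i 1"] by simp
qed

text \<open>A dyadic cube lies on one side of the wall it touches, hence the interval has to avoid \<open>0\<close>.\<close>

lemma cumulative_interval:
  fixes \<phi>0 \<phi> :: "real^'n::finite \<Rightarrow> complex"
  assumes ap: "admissible_pair \<phi>0 \<phi>"
  obtains a b c where "a < b" "0 < a \<or> b < 0" "0 < c" "\<And>t. a \<le> t \<Longrightarrow> t \<le> b \<Longrightarrow> c \<le> norm (cumulative i \<phi> t)"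
proof -
  have \<phi>: "integrable lborel \<phi>"
    using ap Schwartz_integrable by (auto simp: admissible_pair_def)
  obtain t where t: "t \<noteq> 0" "cumulative i \<phi> t \<noteq> 0" using cumulative_nonzero[OF ap] by blast
  define c where "c = norm (cumulative i \<phi> t) / 2"
  have c: "0 < c" using t by (simp add: c_def)
  have "((\<lambda>u. norm (cumulative i \<phi> u)) \<longlongrightarrow> norm (cumulative i \<phi> t)) (at_right t)"
    by (intro tendsto_norm cumulative_right_cont[OF \<phi>])
  moreover have "c < norm (cumulative i \<phi> t)" using c by (simp add: c_def)
  ultimately have "eventually (\<lambda>u. c < norm (cumulative i \<phi> u)) (at_right t)"
    by (rule order_tendstoD)
  then obtain d where d: "t < d" "\<And>u. t < u \<Longrightarrow> u < d \<Longrightarrow> c < norm (cumulative i \<phi> u)"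
    unfolding eventually_at_right_field by auto
  \<comment> \<open>For t < 0 the bound t / 2 keeps b negative; for t > 0 the left end point t is
    already positive.\<close>
  define b where "b = (if t < 0 then min ((t + d) / 2) (t / 2) else (t + d) / 2)"
  have "t < b" "b < d" "0 < t \<or> b < 0" using d(1) t(1) by (auto simp: b_def min_def)
  moreover have "c \<le> norm (cumulative i \<phi> u)" if "t \<le> u" "u \<le> b" for u
  proof (cases "u = t")
    case True
    then show ?thesis by (simp add: c_def)
  next
    case False
    then show ?thesis using d(2)[of u] that \<open>b < d\<close> by simp
  qed
  ultimately show thesis using that c by blast
qed

section \<open>Dyadic cubes and sequence norms\<close>

definition dyadic_interval :: "int \<Rightarrow> int \<Rightarrow> real set" where
  "dyadic_interval J l = {2 powr (- J) * l ..< 2 powr (- J) * (l + 1)}"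

lemma dyadic_cube_iff:
  fixes x :: "real^'n::finite"
  shows "x \<in> dyadic_cube J k \<longleftrightarrow> (\<forall>i. x $ i \<in> dyadic_interval J (k $ i))"
proof -
  have p: "2 powi (- J) = 2 powr (- J)"
    using powr_real_of_int'[of 2 "- J"] by simp
  define w where "w = 2 powr (- real_of_int J)"
  have w: "0 < w" by (simp add: w_def)
  have "x \<in> dyadic_cube J k \<longleftrightarrow> (\<exists>y. (\<forall>i. 0 \<le> y $ i \<and> y $ i < 1) \<and> x = w *\<^sub>R (y + (\<chi> i. of_int (k $ i))))"
    unfolding dyadic_cube_def p w_def by (auto simp: image_iff)
  also have "\<dots> \<longleftrightarrow> (\<forall>i. w * k $ i \<le> x $ i \<and> x $ i < w * (k $ i + 1))"
  proof (intro iffI allI)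
    fix i assume "\<exists>y. (\<forall>i. 0 \<le> y $ i \<and> y $ i < 1) \<and> x = w *\<^sub>R (y + (\<chi> i. of_int (k $ i)))"
    then show "w * k $ i \<le> x $ i \<and> x $ i < w * (k $ i + 1)"
      using w by (auto simp: algebra_simps)
  next
    assume *: "\<forall>i. w * k $ i \<le> x $ i \<and> x $ i < w * (k $ i + 1)"
    define y where "y = (\<chi> i. x $ i / w - of_int (k $ i))"
    have "0 \<le> y $ i \<and> y $ i < 1" for i
      using *[rule_format, of i] w by (simp add: y_def field_simps)
    moreover have "x = w *\<^sub>R (y + (\<chi> i. of_int (k $ i)))"
      using w by (simp add: y_def vec_eq_iff)
    ultimately show "\<exists>y. (\<forall>i. 0 \<le> y $ i \<and> y $ i < 1) \<and> x = w *\<^sub>R (y + (\<chi> i. of_int (k $ i)))"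
      by blast
  qed
  finally show ?thesis
    by (simp add: dyadic_interval_def w_def)
qed

lemma indicator_vec_box:
  fixes I :: "'n::finite \<Rightarrow> real set"
  shows "(indicator {x. \<forall>i. x $ i \<in> I i} x :: ennreal) = (\<Prod>i\<in>UNIV. indicator (I i) (x $ i))"
proof (cases "\<forall>i. x $ i \<in> I i")
  case True
  then show ?thesis by simp
next
  case False
  then obtain i where "x $ i \<notin> I i" by blast
  then have "(\<Prod>i\<in>UNIV. indicator (I i) (x $ i)) = (0 :: ennreal)"
    by (intro prod_zero bexI[of _ i]) simp_all
  then show ?thesis using False by simp
qed

lemma vec_box_measurable:
  fixes I :: "'n::finite \<Rightarrow> real set"
  assumes [measurable]: "\<And>i. I i \<in> sets borel"
  shows "{x. \<forall>i. x $ i \<in> I i} \<in> sets borel"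
proof -
  have "{x \<in> space borel. \<forall>i. x $ i \<in> I i} \<in> sets borel" by measurable
  then show ?thesis by simp
qed

lemma emeasure_vec_box:
  fixes I :: "'n::finite \<Rightarrow> real set"
  assumes [measurable]: "\<And>i. I i \<in> sets borel"
  shows "emeasure lborel {x. \<forall>i. x $ i \<in> I i} = (\<Prod>i\<in>UNIV. emeasure lborel (I i))"
proof -
  have "emeasure lborel {x. \<forall>i. x $ i \<in> I i} = (\<integral>\<^sup>+x. indicator {x. \<forall>i. x $ i \<in> I i} x \<partial>lborel)"
    using vec_box_measurable[OF assms] by simp
  also have "\<dots> = (\<Prod>i\<in>UNIV. \<integral>\<^sup>+t. indicator (I i) t \<partial>lborel)"
    unfolding indicator_vec_box by (rule nn_integral_vec_prod) simp
  finally show ?thesis by simp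
qed

lemma dyadic_cube_box: "dyadic_cube J k = {x. \<forall>i. x $ i \<in> dyadic_interval J (k $ i)}"
  by (auto simp: dyadic_cube_iff)

lemma dyadic_interval_measurable [measurable]: "dyadic_interval J l \<in> sets borel"
  by (simp add: dyadic_interval_def)

lemma dyadic_cube_measurable [measurable]: "dyadic_cube J (k :: int^'n::finite) \<in> sets borel"
  unfolding dyadic_cube_box by (rule vec_box_measurable) simp

lemma emeasure_dyadic_interval: "emeasure lborel (dyadic_interval J l) = ennreal (2 powr (- J))"
  unfolding dyadic_interval_def by (subst emeasure_lborel_Ico) (simp_all add: algebra_simps)

lemma measure_dyadic_cube:
  "measure lborel (dyadic_cube J (k :: int^'n::finite)) = 2 powr (- real_of_int J * CARD('n))"
proof -
  have "emeasure lborel (dyadic_cube J k) = (\<Prod>i\<in>(UNIV::'n set). ennreal (2 powr (- J)))"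
    unfolding dyadic_cube_box by (subst emeasure_vec_box) (simp_all add: emeasure_dyadic_interval)
  also have "\<dots> = ennreal (2 powr (- real_of_int J * CARD('n)))"
    by (simp add: ennreal_power powr_realpow[symmetric] powr_powr)
  finally show ?thesis by (simp add: measure_def)
qed

lemma cube_weight:
  "1 / measure lborel (dyadic_cube J (k :: int^'n::finite)) powr \<tau> = 2 powr (real_of_int J * CARD('n) * \<tau>)"
  by (simp add: measure_dyadic_cube powr_powr powr_minus_divide[symmetric])

section \<open>Powers in \<open>ennreal\<close> and sequence norms\<close>

lemma ennreal_power_mono: "x \<le> y \<Longrightarrow> 0 \<le> a \<Longrightarrow> ennreal_power x a \<le> ennreal_power y a"
  by (auto simp: ennreal_power_def top_unique less_top intro!: ennreal_leI powr_mono2 enn2real_mono)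

lemma ennreal_power_ennreal: "0 \<le> x \<Longrightarrow> ennreal_power (ennreal x) a = ennreal (x powr a)"
  by (simp add: ennreal_power_def)

lemma ennreal_power_cmult:
  assumes "0 < c"
  shows "ennreal_power (ennreal c * x) a = ennreal (c powr a) * ennreal_power x a"
  using assms
  by (cases x rule: ennreal_cases)
     (auto simp: ennreal_power_def ennreal_mult[symmetric] ennreal_mult_top powr_mult ennreal_mult_eq_top_iff)

lemma enn2real_pos: "0 < q \<Longrightarrow> q \<noteq> \<infinity> \<Longrightarrow> 0 < enn2real q"
  by (simp add: enn2real_positive_iff less_top)

lemma ennreal_power_power:
  assumes "0 < a" shows "ennreal_power (ennreal_power x a) (1 / a) = x"
  using assms by (cases x rule: ennreal_cases) (auto simp: ennreal_power_def powr_powr)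

lemma lq_norm_mono:
  assumes "0 < q" "\<And>i. b i \<le> b' i"
  shows "lq_norm q b \<le> lq_norm q b'"
  using assms enn2real_pos[of q]
  by (auto simp: lq_norm_def intro!: SUP_mono ennreal_power_mono suminf_le summableI)

lemma lq_norm_cmult:
  assumes "0 < q" "0 < c"
  shows "lq_norm q (\<lambda>i. ennreal c * b i) = ennreal c * lq_norm q b"
proof (cases "q = \<infinity>")
  case True
  then show ?thesis by (simp add: lq_norm_def SUP_mult_left_ennreal)
next
  case False
  then have q: "0 < enn2real q" using assms enn2real_pos by blast
  have "(\<Sum>i. ennreal_power (ennreal c * b i) (enn2real q)) =
      ennreal (c powr enn2real q) * (\<Sum>i. ennreal_power (b i) (enn2real q))"
    using assms by (simp add: ennreal_power_cmult)
  then show ?thesis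
    using False q assms by (simp add: lq_norm_def ennreal_power_cmult powr_powr)
qed

lemma lq_norm_ge:
  assumes "0 < q" shows "b i \<le> lq_norm q b"
proof (cases "q = \<infinity>")
  case True
  then show ?thesis by (simp add: lq_norm_def SUP_upper)
next
  case False
  then have q: "0 < enn2real q" using assms enn2real_pos by blast
  have "ennreal_power (b i) (enn2real q) \<le> (\<Sum>i. ennreal_power (b i) (enn2real q))"
    using sum_le_suminf[OF summableI, of "{i}" "\<lambda>i. ennreal_power (b i) (enn2real q)"] by simp
  then have "ennreal_power (ennreal_power (b i) (enn2real q)) (1 / enn2real q) \<le> lq_norm q b"
    using q False by (simp add: lq_norm_def ennreal_power_mono)
  then show ?thesis using q by (simp add: ennreal_power_power)
qed

lemma two_powr_le_1: "x \<le> 0 \<Longrightarrow> 2 powr x \<le> (1 :: real)"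
  using powr_mono[of x 0 2] by simp

text \<open>At \<delta> = 0 the sequence is constant: bounded, but not q-summable for finite
  q.\<close>

lemma lq_norm_geometric:
  assumes "0 < q" "\<delta> < 0 \<or> \<delta> = 0 \<and> q = \<infinity>"
  shows "lq_norm q (\<lambda>i. ennreal (2 powr (real i * \<delta>))) < \<infinity>"
proof (cases "q = \<infinity>")
  case True
  have "(SUP i. ennreal (2 powr (real i * \<delta>))) \<le> 1"
    using assms by (intro SUP_least) (auto simp: mult_nonneg_nonpos intro!: two_powr_le_1)
  then show ?thesis using True by (auto simp: lq_norm_def intro: le_less_trans)
next
  case False
  then have q: "0 < enn2real q" and \<delta>: "\<delta> < 0" using assms enn2real_pos by auto
  define x where "x = 2 powr (\<delta> * enn2real q)"
  have x: "0 < x" "x < 1"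
    using q \<delta> by (simp_all add: x_def powr_less_one mult_neg_pos)
  have "ennreal_power (ennreal (2 powr (real i * \<delta>))) (enn2real q) = ennreal (x ^ i)" for i
    by (simp add: ennreal_power_ennreal powr_powr x_def powr_realpow[symmetric] mult_ac)
  then have "(\<Sum>i. ennreal_power (ennreal (2 powr (real i * \<delta>))) (enn2real q)) = (\<Sum>i. ennreal (x ^ i))"
    by simp
  also have "\<dots> < \<infinity>"
    using x by (subst suminf_ennreal2) (auto intro: summable_geometric)
  finally show ?thesis
    using False by (simp add: lq_norm_def ennreal_power_def)
qed

text \<open>Infinitely many terms stay above one positive constant; this excludes s = r for finite
  q.\<close>

lemma lq_norm_infinite:
  assumes "0 < q" "q \<noteq> \<infinity>" "0 < c" "\<And>i. L \<le> i \<Longrightarrow> ennreal c \<le> b i"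
  shows "lq_norm q b = \<infinity>"
proof -
  have q: "0 < enn2real q" using assms enn2real_pos by blast
  define d where "d = c powr enn2real q"
  have d: "0 < d" using assms by (simp add: d_def)
  define S where "S = (\<Sum>i. ennreal_power (b i) (enn2real q))"
  have le: "of_nat N * ennreal d \<le> S" for N
  proof -
    have "of_nat N * ennreal d = (\<Sum>i\<in>{L..<L+N}. ennreal d)" by simp
    also have "\<dots> \<le> (\<Sum>i\<in>{L..<L+N}. ennreal_power (b i) (enn2real q))"
    proof (rule sum_mono)
      fix i assume "i \<in> {L..<L+N}"
      then have "ennreal_power (ennreal c) (enn2real q) \<le> ennreal_power (b i) (enn2real q)"
        using assms(4)[of i] q by (intro ennreal_power_mono) auto
      then show "ennreal d \<le> ennreal_power (b i) (enn2real q)"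
        using assms(3) by (simp add: d_def ennreal_power_ennreal)
    qed
    also have "\<dots> \<le> S"
      unfolding S_def by (rule sum_le_suminf[OF summableI]) auto
    finally show ?thesis .
  qed
  have "S = \<infinity>"
  proof (rule ccontr)
    assume "S \<noteq> \<infinity>"
    then obtain r where r: "S = ennreal r" "0 \<le> r" by (cases S rule: ennreal_cases) auto
    obtain N where "r < of_nat N * d" using reals_Archimedean3[OF d] by blast
    moreover have "of_nat N * d \<le> r"
      using le[of N] r d by (simp add: ennreal_of_nat_eq_real_of_nat ennreal_mult[symmetric])
    ultimately show False by simp
  qed
  then show ?thesis using assms(2) by (simp add: lq_norm_def S_def ennreal_power_def)
qed

text \<open>Turns boundedness along an arithmetic progression of exponents into a sign condition; it
  is applied to J and to i separately.\<close>

lemma powr_bounded_imp_nonpos: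
  fixes a \<beta> Y :: real
  assumes "\<And>i::nat. L \<le> i \<Longrightarrow> 2 powr (a + real i * \<beta>) \<le> Y"
  shows "\<beta> \<le> 0"
proof (rule ccontr)
  assume "\<not> \<beta> \<le> 0"
  then have "1 < 2 powr \<beta>" by simp
  then obtain N where N: "Y / 2 powr a < (2 powr \<beta>) ^ N" using real_arch_pow by blast
  also have "(2 powr \<beta>) ^ N \<le> (2 powr \<beta>) ^ (N + L)"
    using \<open>1 < 2 powr \<beta>\<close> by (intro power_increasing) auto
  finally have "Y < 2 powr a * (2 powr \<beta>) ^ (N + L)" by (simp add: field_simps)
  also have "\<dots> = 2 powr (a + real (N + L) * \<beta>)"
    by (simp only: powr_power powr_add[symmetric] mult.commute)
  finally show False using assms[of "N + L"] by simp
qed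

section \<open>From norms on dyadic cubes to the conditions on s\<close>

text \<open>With j = nat J + i the bound factors into a term in J and 2^(i (s - r)). The second
  condition makes the sequence norm \<open>K\<close> over i finite; the first bounds the term in J
  multiplied by the weight of the cube.\<close>

lemma besov_type_norm_finiteI:
  fixes \<phi>0 \<phi> :: "real^'n::finite \<Rightarrow> complex"
  assumes "0 \<le> \<tau>" "0 < q" "0 < C"
    and upper: "\<And>J k j. Lp_norm p (dyadic_cube J k) (convolution_dist (phi_seq \<phi>0 \<phi> j) T) \<le>
      ennreal (C * 2 powr (- (real j + real (nat J) * (real CARD('n) - 1)) * r))"
    and s: "s \<le> real CARD('n) * (r - \<tau>)" "s < r \<or> s = r \<and> q = \<infinity>"
  shows "besov_type_norm \<phi>0 \<phi> s \<tau> p q T < \<infinity>"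
proof -
  let ?n = "real CARD('n)"
  define K where "K = lq_norm q (\<lambda>i. ennreal (2 powr (real i * (s - r))))"
  have K: "K < \<infinity>" unfolding K_def using s assms by (intro lq_norm_geometric) auto
  have "besov_type_norm \<phi>0 \<phi> s \<tau> p q T \<le> ennreal C * K"
    unfolding besov_type_norm_def Let_def
  proof (rule SUP_least, clarify)
    fix J :: int and k :: "int^'n"
    let ?N = "real (nat J)"
    let ?A = "\<lambda>j. Lp_norm p (dyadic_cube J k) (convolution_dist (phi_seq \<phi>0 \<phi> j) T)"
    have "ennreal (2 powr (real (nat J + i) * s)) * ?A (nat J + i) \<le>
        ennreal (C * 2 powr (?N * (s - ?n * r))) * ennreal (2 powr (real i * (s - r)))" for i
    proof -
      have "ennreal (2 powr (real (nat J + i) * s)) * ?A (nat J + i) \<le> ennreal (2 powr (real (nat J + i) * s)) *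
          ennreal (C * 2 powr (- (real (nat J + i) + ?N * (?n - 1)) * r))"
        by (intro mult_left_mono upper) auto
      also have "\<dots> = ennreal (C * (2 powr (real (nat J + i) * s) * 2 powr (- (real (nat J + i) + ?N * (?n - 1)) * r)))"
        using assms by (simp add: ennreal_mult[symmetric] mult_ac)
      also have "2 powr (real (nat J + i) * s) * 2 powr (- (real (nat J + i) + ?N * (?n - 1)) * r)
          = 2 powr (?N * (s - ?n * r)) * 2 powr (real i * (s - r))"
        unfolding powr_add[symmetric] by (rule arg_cong[where f="(powr) 2"]) (simp add: algebra_simps)
      finally show ?thesis
        using assms by (simp add: ennreal_mult[symmetric] mult_ac)
    qed
    then have "lq_norm q (\<lambda>i. ennreal (2 powr (real (nat J + i) * s)) * ?A (nat J + i)) \<le>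
        lq_norm q (\<lambda>i. ennreal (C * 2 powr (?N * (s - ?n * r))) * ennreal (2 powr (real i * (s - r))))"
      by (intro lq_norm_mono assms)
    also have "\<dots> = ennreal (C * 2 powr (?N * (s - ?n * r))) * K"
      unfolding K_def using assms by (intro lq_norm_cmult) auto
    \<comment> \<open>For J < 0 the weight is at most 1 and is enlarged to its value at J = 0; this
      uses \<tau> \<ge> 0.\<close>
    finally have "ennreal (1 / measure lborel (dyadic_cube J k) powr \<tau>) *
        lq_norm q (\<lambda>i. ennreal (2 powr (real (nat J + i) * s)) * ?A (nat J + i)) \<le>
        ennreal (2 powr (?N * ?n * \<tau>)) * (ennreal (C * 2 powr (?N * (s - ?n * r))) * K)"
      unfolding cube_weight using assms(1)
      by (intro mult_mono ennreal_leI powr_mono mult_right_mono) auto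
    also have "\<dots> = ennreal (2 powr (?N * ?n * \<tau>) * (C * 2 powr (?N * (s - ?n * r)))) * K"
      using assms(3) by (subst ennreal_mult) (auto simp: mult.assoc)
    also have "2 powr (?N * ?n * \<tau>) * (C * 2 powr (?N * (s - ?n * r))) = C * 2 powr (?N * (s - ?n * (r - \<tau>)))"
      by (simp add: powr_add[symmetric] algebra_simps)
    also have "ennreal (C * 2 powr (?N * (s - ?n * (r - \<tau>)))) * K \<le> ennreal C * K"
    proof (intro mult_right_mono ennreal_leI)
      have "2 powr (?N * (s - ?n * (r - \<tau>))) \<le> 1"
        using s(1) by (intro two_powr_le_1) (auto simp: mult_nonneg_nonpos)
      then show "C * 2 powr (?N * (s - ?n * (r - \<tau>))) \<le> C" using assms(3) by simp
    qed simp
    finally show "ennreal (1 / measure lborel (dyadic_cube J k) powr \<tau>) *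
        lq_norm q (\<lambda>i. ennreal (2 powr (real (nat J + i) * s)) * ?A (nat J + i)) \<le> ennreal C * K" .
  qed
  also have "\<dots> < \<infinity>" using K by (simp add: ennreal_mult_less_top)
  finally show ?thesis .
qed

text \<open>One cube per level is enough, and since L does not depend on J, the parameters J and i
  can tend to infinity separately.\<close>

lemma besov_type_norm_finiteD:
  fixes \<phi>0 \<phi> :: "real^'n::finite \<Rightarrow> complex"
  assumes q: "0 < q" and c: "0 < c"
    and lower: "\<And>J. J0 \<le> J \<Longrightarrow> \<exists>k. \<forall>j\<ge>J + L. ennreal (c * 2 powr (- (real j + real J * (real CARD('n) - 1)) * r))
      \<le> Lp_norm p (dyadic_cube (int J) k) (convolution_dist (phi_seq \<phi>0 \<phi> j) T)"
    and fin: "besov_type_norm \<phi>0 \<phi> s \<tau> p q T < \<infinity>"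
  shows "s \<le> real CARD('n) * (r - \<tau>)" and "s < r \<or> s = r \<and> q = \<infinity>"
proof -
  let ?n = "real CARD('n)"
  define X where "X = besov_type_norm \<phi>0 \<phi> s \<tau> p q T"
  have X: "X \<noteq> \<infinity>" using fin by (simp add: X_def)
  define F where "F J k = lq_norm q (\<lambda>i. ennreal (2 powr (real (J + i) * s)) *
      Lp_norm p (dyadic_cube (int J) k) (convolution_dist (phi_seq \<phi>0 \<phi> (J + i)) T))" for J and k :: "int^'n"
  have F: "ennreal (2 powr (real J * ?n * \<tau>)) * F J k \<le> X" for J k
    using SUP_upper[of "(int J, k)" UNIV "\<lambda>(J, k). ennreal (1 / measure lborel (dyadic_cube J k) powr \<tau>) *
        lq_norm q (\<lambda>i. let j = nat J + i in
          ennreal (2 powr (real j * s)) *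
          Lp_norm p (dyadic_cube J k) (convolution_dist (phi_seq \<phi>0 \<phi> j) T))"]
    by (simp add: X_def besov_type_norm_def F_def cube_weight Let_def)
  have low: "\<exists>k. \<forall>i\<ge>L. ennreal (c * 2 powr (real J * (s - ?n * r) + real i * (s - r))) \<le>
      ennreal (2 powr (real (J + i) * s)) *
      Lp_norm p (dyadic_cube (int J) k) (convolution_dist (phi_seq \<phi>0 \<phi> (J + i)) T)" if "J0 \<le> J" for J
  proof -
    obtain k where k: "\<And>j. j \<ge> J + L \<Longrightarrow> ennreal (c * 2 powr (- (real j + real J * (?n - 1)) * r))
      \<le> Lp_norm p (dyadic_cube (int J) k) (convolution_dist (phi_seq \<phi>0 \<phi> j) T)"
      using lower[OF \<open>J0 \<le> J\<close>] by blast
    have "ennreal (c * 2 powr (real J * (s - ?n * r) + real i * (s - r))) \<le>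
      ennreal (2 powr (real (J + i) * s)) *
      Lp_norm p (dyadic_cube (int J) k) (convolution_dist (phi_seq \<phi>0 \<phi> (J + i)) T)" if "i \<ge> L" for i
    proof -
      have "c * 2 powr (real J * (s - ?n * r) + real i * (s - r)) =
          2 powr (real (J + i) * s) * (c * 2 powr (- (real (J + i) + real J * (?n - 1)) * r))"
        by (simp add: powr_add[symmetric] algebra_simps)
      also have "ennreal \<dots> = ennreal (2 powr (real (J + i) * s)) * ennreal (c * 2 powr (- (real (J + i) + real J * (?n - 1)) * r))"
        using c by (intro ennreal_mult) auto
      also have "\<dots> \<le> ennreal (2 powr (real (J + i) * s)) *
          Lp_norm p (dyadic_cube (int J) k) (convolution_dist (phi_seq \<phi>0 \<phi> (J + i)) T)"
        using that by (intro mult_left_mono k) auto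
      finally show ?thesis .
    qed
    then show ?thesis by blast
  qed
  define Y where "Y = enn2real X"
  have XY: "X = ennreal Y" "0 \<le> Y" using X by (simp_all add: Y_def less_top)
  have bound: "2 powr (real J * (s - ?n * (r - \<tau>)) + real i * (s - r)) \<le> Y / c" if ij: "J0 \<le> J" "L \<le> i" for J i
  proof -
    obtain k where k: "ennreal (c * 2 powr (real J * (s - ?n * r) + real i * (s - r))) \<le>
      ennreal (2 powr (real (J + i) * s)) *
      Lp_norm p (dyadic_cube (int J) k) (convolution_dist (phi_seq \<phi>0 \<phi> (J + i)) T)"
      using low[OF ij(1)] ij(2) by blast
    also have "\<dots> \<le> F J k" unfolding F_def by (rule lq_norm_ge[OF q])
    finally have "ennreal (2 powr (real J * ?n * \<tau>)) * ennreal (c * 2 powr (real J * (s - ?n * r) + real i * (s - r))) \<le>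
        ennreal (2 powr (real J * ?n * \<tau>)) * F J k"
      by (intro mult_left_mono) auto
    also note F
    finally have "2 powr (real J * ?n * \<tau>) * (c * 2 powr (real J * (s - ?n * r) + real i * (s - r))) \<le> Y"
      using c XY by (simp add: ennreal_mult[symmetric])
    moreover have "2 powr (real J * ?n * \<tau>) * (c * 2 powr (real J * (s - ?n * r) + real i * (s - r))) =
        c * 2 powr (real J * (s - ?n * (r - \<tau>)) + real i * (s - r))"
      by (simp add: powr_add[symmetric] algebra_simps)
    ultimately show ?thesis using c by (simp add: field_simps)
  qed
  \<comment> \<open>Here i = L is fixed and J grows.\<close>
  have "s - ?n * (r - \<tau>) \<le> 0"
  proof (rule powr_bounded_imp_nonpos)
    show "2 powr (real L * (s - r) + real J * (s - ?n * (r - \<tau>))) \<le> Y / c" if "J0 \<le> J" for J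
      using bound[OF that order_refl] by (simp add: add.commute)
  qed
  then show "s \<le> ?n * (r - \<tau>)" by simp
  \<comment> \<open>Here J = J0 is fixed and i grows.\<close>
  have le: "s - r \<le> 0"
  proof (rule powr_bounded_imp_nonpos)
    show "2 powr (real J0 * (s - ?n * (r - \<tau>)) + real i * (s - r)) \<le> Y / c" if "L \<le> i" for i
      using bound[OF order_refl that] .
  qed
  show "s < r \<or> s = r \<and> q = \<infinity>"
  proof (rule ccontr)
    assume "\<not> ?thesis"
    then have sr: "s = r" and q': "q \<noteq> \<infinity>" using le by auto
    obtain k where k: "\<And>i. L \<le> i \<Longrightarrow> ennreal (c * 2 powr (real J0 * (s - ?n * r) + real i * (s - r))) \<le>
      ennreal (2 powr (real (J0 + i) * s)) *
      Lp_norm p (dyadic_cube (int J0) k) (convolution_dist (phi_seq \<phi>0 \<phi> (J0 + i)) T)"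
      using low[OF order_refl] by blast
    \<comment> \<open>At s = r the lower bounds for the terms over one cube of level J0 do not decay
      in i.\<close>
    have "F J0 k = \<infinity>"
      unfolding F_def
    proof (rule lq_norm_infinite[OF q q'])
      show "0 < c * 2 powr (real J0 * (s - ?n * r))" using c by simp
      show "ennreal (c * 2 powr (real J0 * (s - ?n * r))) \<le> ennreal (2 powr (real (J0 + i) * s)) *
        Lp_norm p (dyadic_cube (int J0) k) (convolution_dist (phi_seq \<phi>0 \<phi> (J0 + i)) T)" if "L \<le> i" for i
        using k[OF that] sr by simp
    qed
    then show False using F[of J0 k] X by (simp add: ennreal_mult_top top_unique)
  qed
qed

section \<open>Upper bounds\<close>

lemma nn_integral_bump_affine:
  "(\<integral>\<^sup>+t. ennreal (bump (2 ^ j * (t - a))) \<partial>lborel) = ennreal (pi * 2 powr (- real j))"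
proof -
  have "(\<integral>\<^sup>+t. ennreal (bump (2 ^ j * (t - a))) \<partial>lborel) =
      ennreal \<bar>1 / 2 ^ j\<bar> * (\<integral>\<^sup>+t. ennreal (bump (2 ^ j * ((a + (1 / 2 ^ j) * t) - a))) \<partial>lborel)"
    by (rule nn_integral_real_affine) simp_all
  also have "\<dots> = ennreal (1 / 2 ^ j) * ennreal pi"
    by (simp add: nn_integral_bump)
  finally show ?thesis
    by (simp add: ennreal_mult[symmetric] powr_minus_divide powr_realpow)
qed

text \<open>For J \<ge> 0 the length of the interval serves as bound, for J < 0 the total integral
  pi; \<open>nat J\<close> covers both, and pi \<ge> 1 gives a common constant.\<close>

lemma nn_integral_bump_dyadic:
  "(\<integral>\<^sup>+t. ennreal (bump t) * indicator (dyadic_interval J l) t \<partial>lborel) \<le> ennreal (pi * 2 powr (- real (nat J)))"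
proof (cases "0 \<le> J")
  case True
  have "(\<integral>\<^sup>+t. ennreal (bump t) * indicator (dyadic_interval J l) t \<partial>lborel) \<le>
      (\<integral>\<^sup>+t. indicator (dyadic_interval J l) t \<partial>lborel)"
    using bump_le_1 by (intro nn_integral_mono) (auto simp: indicator_def)
  also have "\<dots> = ennreal (2 powr (- real (nat J)))"
    using True by (simp add: emeasure_dyadic_interval)
  also have "\<dots> \<le> ennreal (pi * 2 powr (- real (nat J)))"
    using pi_ge_two by (intro ennreal_leI) simp
  finally show ?thesis .
next
  case False
  have "(\<integral>\<^sup>+t. ennreal (bump t) * indicator (dyadic_interval J l) t \<partial>lborel) \<le> (\<integral>\<^sup>+t. ennreal (bump t) \<partial>lborel)"
    by (intro nn_integral_mono) (auto simp: indicator_def)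
  then show ?thesis using False by (simp add: nn_integral_bump)
qed

text \<open>Direction i, in which the cube is replaced by the whole line, contributes the strip
  width 2^(-j); each of the n - 1 other directions contributes the factor for its side.\<close>

lemma nn_integral_slab_bump:
  fixes i :: "'n::finite"
  shows "(\<integral>\<^sup>+x\<in>dyadic_cube J k. ennreal (\<Prod>l\<in>UNIV. if l = i then bump (2 ^ j * (x $ l - a)) else bump (x $ l)) \<partial>lborel)
    \<le> ennreal (pi ^ CARD('n) * 2 powr (- (real j + real (nat J) * (real CARD('n) - 1))))"
proof -
  define g where "g l t = ennreal (if l = i then bump (2 ^ j * (t - a)) else bump t) *
      indicator (dyadic_interval J (k $ l)) t" for l t
  have nn: "0 \<le> (if l = i then bump (2 ^ j * (t - a)) else bump t)" for l t
    using bump_pos less_imp_le by auto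
  have "(\<integral>\<^sup>+x\<in>dyadic_cube J k. ennreal (\<Prod>l\<in>UNIV. if l = i then bump (2 ^ j * (x $ l - a)) else bump (x $ l)) \<partial>lborel)
      = (\<integral>\<^sup>+x. (\<Prod>l\<in>UNIV. g l (x $ l)) \<partial>lborel)"
    unfolding dyadic_cube_box indicator_vec_box prod_ennreal[OF nn, symmetric] prod.distrib[symmetric] g_def ..
  also have "\<dots> = (\<Prod>l\<in>UNIV. \<integral>\<^sup>+t. g l t \<partial>lborel)"
    by (rule nn_integral_vec_prod) (simp add: g_def)
  also have "\<dots> \<le> (\<Prod>l\<in>UNIV. ennreal (pi * (if l = i then 2 powr (- real j) else 2 powr (- real (nat J)))))"
  proof (intro prod_mono_ennreal)
    fix l
    show "(\<integral>\<^sup>+t. g l t \<partial>lborel) \<le> ennreal (pi * (if l = i then 2 powr (- real j) else 2 powr (- real (nat J))))"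
    proof (cases "l = i")
      case True
      have "(\<integral>\<^sup>+t. g l t \<partial>lborel) \<le> (\<integral>\<^sup>+t. ennreal (bump (2 ^ j * (t - a))) \<partial>lborel)"
        using True by (intro nn_integral_mono) (auto simp: g_def indicator_def)
      then show ?thesis using True by (simp add: nn_integral_bump_affine)
    next
      case False
      then show ?thesis using nn_integral_bump_dyadic by (simp add: g_def)
    qed
  qed
  also have "\<dots> = ennreal (\<Prod>l\<in>(UNIV::'n set). pi * (if l = i then 2 powr (- real j) else 2 powr (- real (nat J))))"
    by (rule prod_ennreal) simp
  also have "(\<Prod>l\<in>(UNIV::'n set). pi * (if l = i then 2 powr (- real j) else 2 powr (- real (nat J)))) =
      pi ^ CARD('n) * (2 powr (- real j) * (\<Prod>l\<in>(UNIV - {i}). 2 powr (- real (nat J))))"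
    by (simp add: prod.distrib prod.remove[of UNIV i])
  also have "(\<Prod>l\<in>(UNIV - {i}). 2 powr (- real (nat J))) = 2 powr (- (real (nat J) * (real CARD('n) - 1)))"
    by (simp add: powr_power of_nat_diff mult.commute)
  finally show ?thesis
    by (simp add: powr_add[symmetric])
qed

text \<open>\<open>W\<close> is a set of walls \<open>(i, a)\<close>, standing for the hyperplanes \<open>x\<^sub>i = a\<close>. For \<open>j = 0\<close>, where the kernel
  need not have integral zero, the distance to a wall is controlled by \<open>norm x\<close>.\<close>

lemma convolution_bounds:
  fixes f \<phi>0 \<phi> :: "real^'n::finite \<Rightarrow> complex"
  assumes ap: "admissible_pair \<phi>0 \<phi>"
    and f [measurable]: "f \<in> borel_measurable borel" and fB: "\<And>x. norm (f x) \<le> B"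
    and W: "finite W" "W \<noteq> {}"
    and const: "\<forall>x y d. (\<forall>(i, a)\<in>W. d \<le> \<bar>x $ i - a\<bar>) \<longrightarrow> norm (y - x) < d \<longrightarrow> f y = f x"
    and supp: "0 \<le> R" "\<forall>y. R < norm y \<longrightarrow> f y = 0"
  obtains D where "0 < D"
    and "\<And>j x. norm (convolution_dist (phi_seq \<phi>0 \<phi> j) (regular_dist f) x) \<le> D * inverse ((1 + norm x) ^ N)"
    and "\<And>j x. \<exists>(i, a)\<in>W. norm (convolution_dist (phi_seq \<phi>0 \<phi> j) (regular_dist f) x) \<le>
      D * inverse ((1 + 2 ^ j * \<bar>x $ i - a\<bar>) ^ N)"
proof -
  have S: "\<phi>0 \<in> Schwartz" "\<phi> \<in> Schwartz" using ap by (auto simp: admissible_pair_def)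
  define G where "G j x = norm (convolution_dist (phi_seq \<phi>0 \<phi> j) (regular_dist f) x)" for j x
  have G: "G j x = norm (LINT v|lborel. f (x - (1 / 2 ^ j) *\<^sub>R v) * mother \<phi>0 \<phi> j v)" for j x
    unfolding G_def convolution_regular_dist[OF S f] ..
  have B: "0 \<le> B" using order_trans[OF norm_ge_zero fB] .
  obtain C1 where C1: "C1 \<ge> 0"
    "\<And>g h B r. \<lbrakk>g \<in> borel_measurable borel; h \<in> borel_measurable borel; \<And>v. norm (g v) \<le> B;
      \<And>v. norm (h v) \<le> B; 0 \<le> r; \<And>v. norm v < r \<Longrightarrow> g v = h v\<rbrakk> \<Longrightarrow>
      norm ((LINT v|lborel. g v * \<phi>0 v) - (LINT v|lborel. h v * \<phi>0 v)) \<le> C1 * B * inverse ((1 + r) ^ N)"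
    using integral_diff_tail[OF S(1), of N] by blast
  obtain C2 where C2: "C2 \<ge> 0"
    "\<And>g h B r. \<lbrakk>g \<in> borel_measurable borel; h \<in> borel_measurable borel; \<And>v. norm (g v) \<le> B;
      \<And>v. norm (h v) \<le> B; 0 \<le> r; \<And>v. norm v < r \<Longrightarrow> g v = h v\<rbrakk> \<Longrightarrow>
      norm ((LINT v|lborel. g v * \<phi> v) - (LINT v|lborel. h v * \<phi> v)) \<le> C2 * B * inverse ((1 + r) ^ N)"
    using integral_diff_tail[OF S(2), of N] by blast
  \<comment> \<open>One constant for both kernels, so that the decay bound holds uniformly in j,
    including j = 0.\<close>
  define C where "C = max C1 C2"
  have C0: "0 \<le> C" using C1(1) by (simp add: C_def)
  have C: "norm ((LINT v|lborel. g v * mother \<phi>0 \<phi> j v) - (LINT v|lborel. h v * mother \<phi>0 \<phi> j v)) \<le>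
      C * B * inverse ((1 + r) ^ N)"
    if "g \<in> borel_measurable borel" "h \<in> borel_measurable borel" "\<And>v. norm (g v) \<le> B"
      "\<And>v. norm (h v) \<le> B" "0 \<le> r" "\<And>v. norm v < r \<Longrightarrow> g v = h v" for g h r j
  proof (cases "j = 0")
    case True
    have "norm ((LINT v|lborel. g v * \<phi>0 v) - (LINT v|lborel. h v * \<phi>0 v)) \<le> C1 * B * inverse ((1 + r) ^ N)"
      by (rule C1(2)) (use that in auto)
    also have "\<dots> \<le> C * B * inverse ((1 + r) ^ N)"
      using B that(5) by (intro mult_right_mono) (auto simp: C_def)
    finally show ?thesis using True by (simp add: mother_def)
  next
    case False
    have "norm ((LINT v|lborel. g v * \<phi> v) - (LINT v|lborel. h v * \<phi> v)) \<le> C2 * B * inverse ((1 + r) ^ N)"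
      by (rule C2(2)) (use that in auto)
    also have "\<dots> \<le> C * B * inverse ((1 + r) ^ N)"
      using B that(5) by (intro mult_right_mono) (auto simp: C_def)
    finally show ?thesis using False by (simp add: mother_def)
  qed
  define A where "A = Max ((\<lambda>(i, a). \<bar>a\<bar>) ` W)"
  have A: "\<bar>a\<bar> \<le> A" if "(i, a) \<in> W" for i a
    unfolding A_def using W that by (intro Max_ge) (auto intro: rev_image_eqI)
  have A0: "0 \<le> A" using W(2) A order_trans[OF abs_ge_zero] by (metis all_not_in_conv surj_pair)
  define D1 where "D1 = C * B * (1 + R) ^ N"
  have D1: "0 \<le> D1" using C0 B supp(1) by (simp add: D1_def)
  have decay: "G j x \<le> D1 * inverse ((1 + norm x) ^ N)" for j x
  proof -
    \<comment> \<open>Since 2^(-j) \<le> 1, moving x by 2^(-j) v with norm v < r does not reach the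
      support of f.\<close>
    define r where "r = max 0 (norm x - R)"
    have r: "0 \<le> r" by (simp add: r_def)
    have z: "f (x - (1 / 2 ^ j) *\<^sub>R v) = 0" if "norm v < r" for v
    proof (rule supp(2)[rule_format])
      have "norm ((1 / 2 ^ j) *\<^sub>R v) \<le> norm v"
        by (simp add: divide_le_eq mult_le_cancel_left1)
      then have "norm ((1 / 2 ^ j) *\<^sub>R v) < r" using that by linarith
      moreover have "r = norm x - R"
        using le_less_trans[OF norm_ge_zero that] by (auto simp: r_def max_def split: if_splits)
      ultimately show "R < norm (x - (1 / 2 ^ j) *\<^sub>R v)"
        using norm_triangle_ineq2[of x "(1 / 2 ^ j) *\<^sub>R v"] by linarith
    qed
    have "G j x = norm ((LINT v|lborel. f (x - (1 / 2 ^ j) *\<^sub>R v) * mother \<phi>0 \<phi> j v) - (LINT v|lborel. 0 * mother \<phi>0 \<phi> j v))"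
      by (simp add: G)
    also have "\<dots> \<le> C * B * inverse ((1 + r) ^ N)"
      by (rule C) (use fB B r z in auto)
    also have "\<dots> \<le> C * B * ((1 + R) ^ N * inverse ((1 + norm x) ^ N))"
    proof (intro mult_left_mono)
      have "norm x \<le> R + r" "0 \<le> R * r"
        using supp(1) r by (auto simp: r_def)
      then have "1 + norm x \<le> (1 + R) * (1 + r)"
        by (simp add: algebra_simps)
      then have "(1 + norm x) ^ N \<le> (1 + R) ^ N * (1 + r) ^ N"
        unfolding power_mult_distrib[symmetric] by (intro power_mono) auto
      moreover have "0 < (1 + norm x) ^ N" "0 < (1 + r) ^ N" using r by (auto simp: add_pos_nonneg)
      ultimately show "inverse ((1 + r) ^ N) \<le> (1 + R) ^ N * inverse ((1 + norm x) ^ N)"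
        by (simp add: field_simps)
    qed (use C0 B in auto)
    finally show ?thesis by (simp add: D1_def mult_ac)
  qed
  \<comment> \<open>\<open>D\<close> serves the decay bound and the wall bound for j = 0 and for j >
    0; the summand 1 makes it positive.\<close>
  define D where "D = D1 * (1 + A) ^ N + C * B + 1"
  have D: "0 < D" "D1 \<le> D" "D1 * (1 + A) ^ N \<le> D" "C * B \<le> D"
  proof -
    have "D1 \<le> D1 * (1 + A) ^ N" using D1 A0 by (simp add: mult_le_cancel_left1)
    moreover have "0 \<le> C * B" "0 \<le> D1 * (1 + A) ^ N" using C0 B D1 A0 by auto
    ultimately show "0 < D" "D1 \<le> D" "D1 * (1 + A) ^ N \<le> D" "C * B \<le> D" by (auto simp: D_def)
  qed
  show thesis
  proof (rule that[OF D(1)])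
    fix j and x :: "real^'n"
    have "D1 * inverse ((1 + norm x) ^ N) \<le> D * inverse ((1 + norm x) ^ N)"
      by (rule mult_right_mono[OF D(2)]) simp
    then show "norm (convolution_dist (phi_seq \<phi>0 \<phi> j) (regular_dist f) x) \<le> D * inverse ((1 + norm x) ^ N)"
      using decay[of j x] unfolding G_def by linarith
    show "\<exists>(i, a)\<in>W. norm (convolution_dist (phi_seq \<phi>0 \<phi> j) (regular_dist f) x) \<le>
        D * inverse ((1 + 2 ^ j * \<bar>x $ i - a\<bar>) ^ N)"
    proof -
      \<comment> \<open>The nearest wall is chosen: the open ball about x with the distance to it as
        radius meets no wall, so f is constant there.\<close>
      obtain w where w: "is_arg_min (\<lambda>w. \<bar>x $ fst w - snd w\<bar>) (\<lambda>w. w \<in> W) w"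
        using ex_is_arg_min_if_finite[OF W] by blast
      obtain i a where "w = (i, a)" by (cases w)
      then have ia: "(i, a) \<in> W" "\<forall>(i', a')\<in>W. \<bar>x $ i - a\<bar> \<le> \<bar>x $ i' - a'\<bar>"
        using w by (auto simp: is_arg_min_linorder)
      define d where "d = \<bar>x $ i - a\<bar>"
      have d: "0 \<le> d" by (simp add: d_def)
      have "G j x \<le> D * inverse ((1 + 2 ^ j * d) ^ N)"
      proof (cases "j = 0")
        case True
        have "d \<le> norm x + A"
          using component_le_norm_cart[of x i] A[OF ia(1)] by (simp add: d_def)
        also have "\<dots> \<le> norm x + A * (1 + norm x)" using A0 by (simp add: algebra_simps)
        finally have "1 + d \<le> (1 + A) * (1 + norm x)" by (simp add: algebra_simps)
        then have "(1 + d) ^ N \<le> (1 + A) ^ N * (1 + norm x) ^ N"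
          unfolding power_mult_distrib[symmetric] using d by (intro power_mono) auto
        moreover have "0 < (1 + norm x) ^ N" "0 < (1 + d) ^ N" using d by (auto simp: add_pos_nonneg)
        ultimately have "inverse ((1 + norm x) ^ N) \<le> (1 + A) ^ N * inverse ((1 + d) ^ N)"
          by (simp add: field_simps)
        then have "D1 * inverse ((1 + norm x) ^ N) \<le> D1 * (1 + A) ^ N * inverse ((1 + d) ^ N)"
          using D1 by (simp add: mult_left_mono mult.assoc)
        also have "\<dots> \<le> D * inverse ((1 + d) ^ N)"
          using d by (intro mult_right_mono D) auto
        finally show ?thesis using decay[of j x] True by simp
      next
        case False
        \<comment> \<open>Cancellation: the constant f x may be subtracted under the integral, which
          leaves only the part of the kernel that reaches a wall.\<close>
        have "(LINT v|lborel. f x * mother \<phi>0 \<phi> j v) = 0"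
          using False admissible_integral_zero[OF ap] by (simp add: mother_def)
        then have "G j x = norm ((LINT v|lborel. f (x - (1 / 2 ^ j) *\<^sub>R v) * mother \<phi>0 \<phi> j v) - (LINT v|lborel. f x * mother \<phi>0 \<phi> j v))"
          by (simp only: G diff_zero)
        also have "\<dots> \<le> C * B * inverse ((1 + 2 ^ j * d) ^ N)"
        proof (rule C)
          fix v :: "real^'n" assume "norm v < 2 ^ j * d"
          then have "norm ((x - (1 / 2 ^ j) *\<^sub>R v) - x) < d" by (simp add: field_simps)
          then show "f (x - (1 / 2 ^ j) *\<^sub>R v) = f x"
            using ia(2) const unfolding d_def by blast
        qed (use fB d in auto)
        also have "\<dots> \<le> D * inverse ((1 + 2 ^ j * d) ^ N)"
          using d by (intro mult_right_mono D) auto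
        finally show ?thesis .
      qed
      then show ?thesis using ia(1) unfolding G_def d_def by blast
    qed
  qed
qed

lemma recip_finite:
  assumes "0 < p" "p \<noteq> \<infinity>"
  shows "recip p = 1 / enn2real p"
proof -
  define p' where "p' = enn2real p"
  have "0 < p'" using enn2real_pos[OF assms] by (simp add: p'_def)
  moreover have "p = ennreal p'" using assms by (simp add: p'_def less_top)
  ultimately show ?thesis by (simp add: recip_def divide_ennreal flip: ennreal_1)
qed

text \<open>For finite p, the minimum of the two pointwise bounds is turned into a product: some
  powers go to the distance from the wall and produce the strip, the others to norm x and give
  integrability along it.\<close>

lemma Lp_norm_upper_bound:
  fixes f \<phi>0 \<phi> :: "real^'n::finite \<Rightarrow> complex"
  assumes ap: "admissible_pair \<phi>0 \<phi>"
    and f: "f \<in> borel_measurable borel" "\<And>x. norm (f x) \<le> B"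
    and W: "finite W" "W \<noteq> {}"
    and const: "\<forall>x y d. (\<forall>(i, a)\<in>W. d \<le> \<bar>x $ i - a\<bar>) \<longrightarrow> norm (y - x) < d \<longrightarrow> f y = f x"
    and supp: "0 \<le> R" "\<forall>y. R < norm y \<longrightarrow> f y = 0"
    and p: "0 < p"
  obtains C where "0 < C"
    and "\<And>J k j. Lp_norm p (dyadic_cube J k) (convolution_dist (phi_seq \<phi>0 \<phi> j) (regular_dist f)) \<le>
      ennreal (C * 2 powr (- (real j + real (nat J) * (real CARD('n) - 1)) * recip p))"
proof (cases "p = \<infinity>")
  case True
  have S: "\<phi>0 \<in> Schwartz" "\<phi> \<in> Schwartz" using ap by (auto simp: admissible_pair_def)
  \<comment> \<open>Since 1/p = 0, only boundedness is claimed, hence order 0.\<close>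
  obtain D where D: "0 < D"
    "\<And>j x. norm (convolution_dist (phi_seq \<phi>0 \<phi> j) (regular_dist f) x) \<le> D * inverse ((1 + norm x) ^ 0)"
    "\<And>j x. \<exists>(i, a)\<in>W. norm (convolution_dist (phi_seq \<phi>0 \<phi> j) (regular_dist f) x) \<le>
      D * inverse ((1 + 2 ^ j * \<bar>x $ i - a\<bar>) ^ 0)"
    by (rule convolution_bounds[OF ap f W const supp, where N=0]) (rule that)
  have "Lp_norm p P (convolution_dist (phi_seq \<phi>0 \<phi> j) (regular_dist f)) \<le> ennreal D" for P j
    unfolding Lp_norm_def if_P[OF True]
  proof (rule esssup_I)
    note [measurable] = convolution_measurable[OF S f(1), of j]
    have "(\<lambda>x. ennreal (norm (convolution_dist (phi_seq \<phi>0 \<phi> j) (regular_dist f) x))) \<in> borel_measurable lborel"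
      by measurable
    then show "(\<lambda>x. ennreal (norm (convolution_dist (phi_seq \<phi>0 \<phi> j) (regular_dist f) x)))
        \<in> borel_measurable (restrict_space lborel P)"
      by (rule measurable_restrict_space1)
  qed (use D(2) in \<open>auto intro!: ennreal_leI\<close>)
  then show thesis using that[OF D(1)] True by (simp add: recip_def)
next
  case False
  define p' where "p' = enn2real p"
  have p': "0 < p'" using enn2real_pos[OF p False] by (simp add: p'_def)
  have rp: "recip p = 1 / p'"
    using recip_finite[OF p False] by (simp add: p'_def)
  \<comment> \<open>After raising to the power p, 4 n powers must remain: 2 n for norm x and 2 n for
    the wall, of which two are kept.\<close>
  obtain N :: nat where N: "4 * real CARD('n) \<le> real N * p'"
    using reals_Archimedean3[OF p', rule_format, of "4 * real CARD('n)"] less_imp_le by blast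
  define G where "G j x = norm (convolution_dist (phi_seq \<phi>0 \<phi> j) (regular_dist f) x)" for j x
  obtain D where D': "0 < D"
    "\<And>j x. norm (convolution_dist (phi_seq \<phi>0 \<phi> j) (regular_dist f) x) \<le> D * inverse ((1 + norm x) ^ N)"
    "\<And>j x. \<exists>(i, a)\<in>W. norm (convolution_dist (phi_seq \<phi>0 \<phi> j) (regular_dist f) x) \<le>
      D * inverse ((1 + 2 ^ j * \<bar>x $ i - a\<bar>) ^ N)"
    by (rule convolution_bounds[OF ap f W const supp, where N=N]) (rule that)
  note D = D'[folded G_def]
  define V where "V j i a x = (\<Prod>l\<in>UNIV. if l = i then bump (2 ^ j * (x $ l - a)) else bump (x $ l))"
    for j i a and x :: "real^'n"
  have V0: "0 \<le> V j i a x" for j i a x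
    unfolding V_def using bump_pos less_imp_le by (intro prod_nonneg) auto
  have pw: "\<exists>(i, a)\<in>W. G j x powr p' \<le> D powr p' * V j i a x" for j x
  proof -
    obtain i a where ia: "(i, a) \<in> W" "G j x \<le> D * inverse ((1 + 2 ^ j * \<bar>x $ i - a\<bar>) ^ N)"
      using D(3)[of j x] by blast
    define y where "y = inverse (1 + 2 ^ j * \<bar>x $ i - a\<bar>)"
    define z where "z = inverse (1 + norm x)"
    define m where "m = min y z"
    have y: "0 < y" "y \<le> 1" and z: "0 < z" "z \<le> 1"
      by (auto simp: y_def z_def inverse_le_1_iff add_pos_nonneg)
    have m: "0 < m" "m \<le> 1" "m \<le> y" "m \<le> z" using y z by (auto simp: m_def)
    have "G j x \<le> D * m ^ N"
      using ia(2) D(2)[of j x] by (auto simp: m_def y_def z_def min_def power_inverse)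
    then have "G j x powr p' \<le> (D * m ^ N) powr p'"
      using p' by (intro powr_mono2) (auto simp: G_def)
    also have "\<dots> = D powr p' * m powr (real N * p')"
      using D(1) m by (simp add: powr_mult powr_realpow[symmetric] powr_powr)
    also have "\<dots> \<le> D powr p' * (y\<^sup>2 * z ^ (2 * CARD('n)))"
    proof (intro mult_left_mono)
      have "m powr (real N * p') \<le> m powr (real (4 * CARD('n)))"
        using m N by (intro powr_mono') auto
      also have "\<dots> = m ^ (2 * CARD('n)) * m ^ (2 * CARD('n))"
        using m by (subst powr_realpow) (auto simp: power_add[symmetric])
      also have "\<dots> \<le> m\<^sup>2 * m ^ (2 * CARD('n))"
        using m by (intro mult_right_mono power_decreasing) auto
      also have "\<dots> \<le> y\<^sup>2 * z ^ (2 * CARD('n))"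
        using m by (intro mult_mono power_mono) auto
      finally show "m powr (real N * p') \<le> y\<^sup>2 * z ^ (2 * CARD('n))" .
    qed simp
    also have "\<dots> \<le> D powr p' * V j i a x"
    proof (intro mult_left_mono)
      have "y\<^sup>2 \<le> bump (2 ^ j * (x $ i - a))"
        using bump_bound[of "2 ^ j * (x $ i - a)"] by (simp add: y_def power_inverse abs_mult)
      \<comment> \<open>The factor in direction i is at most 1 and is dropped, which makes room for
        the wall factor.\<close>
      moreover have "z ^ (2 * CARD('n)) \<le> (\<Prod>l\<in>UNIV - {i}. bump (x $ l))"
      proof -
        have "z ^ (2 * CARD('n)) \<le> (\<Prod>l\<in>UNIV. bump (x $ l))"
          using prod_bump_bound[of x] by (simp add: z_def power_inverse)
        also have "\<dots> = bump (x $ i) * (\<Prod>l\<in>UNIV - {i}. bump (x $ l))"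
          by (simp add: prod.remove[of UNIV i])
        also have "\<dots> \<le> 1 * (\<Prod>l\<in>UNIV - {i}. bump (x $ l))"
          using bump_le_1 bump_pos less_imp_le by (intro mult_right_mono prod_nonneg) auto
        finally show ?thesis by simp
      qed
      ultimately have "y\<^sup>2 * z ^ (2 * CARD('n)) \<le> bump (2 ^ j * (x $ i - a)) * (\<Prod>l\<in>UNIV - {i}. bump (x $ l))"
        using z bump_pos less_imp_le by (intro mult_mono) auto
      also have "\<dots> = V j i a x"
        by (simp add: V_def prod.remove[of UNIV i])
      finally show "y\<^sup>2 * z ^ (2 * CARD('n)) \<le> V j i a x" .
    qed simp
    finally show ?thesis using ia(1) by blast
  qed
  define K where "K = D powr p' * (real (card W) * pi ^ CARD('n))"
  have K: "0 < K" using D(1) W by (simp add: K_def card_gt_0_iff)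
  have int: "(\<integral>\<^sup>+x\<in>dyadic_cube J k. ennreal (G j x powr p') \<partial>lborel) \<le>
      ennreal (K * 2 powr (- (real j + real (nat J) * (real CARD('n) - 1))))" for J k j
  proof -
    have Vm [measurable]: "(\<lambda>x. V j i a x) \<in> borel_measurable borel" for i a
      unfolding V_def by measurable
    \<comment> \<open>The wall that governs x varies with x, so the sum over all walls is
      integrated.\<close>
    have "(\<integral>\<^sup>+x\<in>dyadic_cube J k. ennreal (G j x powr p') \<partial>lborel) \<le>
        (\<integral>\<^sup>+x. ennreal (D powr p') * (\<Sum>w\<in>W. ennreal (V j (fst w) (snd w) x) * indicator (dyadic_cube J k) x) \<partial>lborel)"
    proof (rule nn_integral_mono)
      fix x :: "real^'n"
      obtain i a where ia: "(i, a) \<in> W" "G j x powr p' \<le> D powr p' * V j i a x"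
        using pw[of j x] by blast
      have "ennreal (G j x powr p') \<le> ennreal (D powr p') * ennreal (V j i a x)"
        using ia(2) V0 by (simp add: ennreal_mult[symmetric])
      then have "ennreal (G j x powr p') * indicator (dyadic_cube J k) x \<le>
          ennreal (D powr p') * (ennreal (V j i a x) * indicator (dyadic_cube J k) x)"
        by (simp add: mult.assoc[symmetric] mult_right_mono)
      also have "ennreal (V j i a x) * indicator (dyadic_cube J k) x \<le>
          (\<Sum>w\<in>W. ennreal (V j (fst w) (snd w) x) * indicator (dyadic_cube J k) x)"
        using member_le_sum[OF ia(1), of "\<lambda>w. ennreal (V j (fst w) (snd w) x) * indicator (dyadic_cube J k) x"] W(1)
        by simp
      finally show "ennreal (G j x powr p') * indicator (dyadic_cube J k) x \<le>
          ennreal (D powr p') * (\<Sum>w\<in>W. ennreal (V j (fst w) (snd w) x) * indicator (dyadic_cube J k) x)"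
        by (simp add: mult_left_mono)
    qed
    also have "\<dots> = ennreal (D powr p') *
        (\<Sum>w\<in>W. \<integral>\<^sup>+x\<in>dyadic_cube J k. ennreal (V j (fst w) (snd w) x) \<partial>lborel)"
      by (simp add: nn_integral_cmult nn_integral_sum)
    also have "\<dots> \<le> ennreal (D powr p') *
        (\<Sum>w\<in>W. ennreal (pi ^ CARD('n) * 2 powr (- (real j + real (nat J) * (real CARD('n) - 1)))))"
      unfolding V_def by (intro mult_left_mono sum_mono nn_integral_slab_bump) simp
    also have "\<dots> = ennreal (K * 2 powr (- (real j + real (nat J) * (real CARD('n) - 1))))"
      by (simp add: K_def ennreal_of_nat_eq_real_of_nat ennreal_mult[symmetric] mult_ac)
    finally show ?thesis .
  qed
  have "Lp_norm p (dyadic_cube J k) (convolution_dist (phi_seq \<phi>0 \<phi> j) (regular_dist f)) \<le>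
      ennreal (K powr (1 / p') * 2 powr (- (real j + real (nat J) * (real CARD('n) - 1)) * recip p))" for J k j
  proof -
    have "Lp_norm p (dyadic_cube J k) (convolution_dist (phi_seq \<phi>0 \<phi> j) (regular_dist f)) =
        ennreal_power (\<integral>\<^sup>+x\<in>dyadic_cube J k. ennreal (G j x powr p') \<partial>lborel) (1 / p')"
      using False by (simp add: Lp_norm_def G_def p'_def)
    also have "\<dots> \<le> ennreal_power (ennreal (K * 2 powr (- (real j + real (nat J) * (real CARD('n) - 1))))) (1 / p')"
      using p' by (intro ennreal_power_mono int) auto
    also have "\<dots> = ennreal ((K * 2 powr (- (real j + real (nat J) * (real CARD('n) - 1)))) powr (1 / p'))"
      using K by (intro ennreal_power_ennreal) simp
    also have "(K * 2 powr (- (real j + real (nat J) * (real CARD('n) - 1)))) powr (1 / p') =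
        K powr (1 / p') * 2 powr (- (real j + real (nat J) * (real CARD('n) - 1)) * recip p)"
      using K by (simp add: powr_mult powr_powr rp)
    finally show ?thesis .
  qed
  then show thesis using that[of "K powr (1 / p')"] K by simp
qed

section \<open>Lower bounds\<close>

text \<open>After rescaling, f and c times the half-space indicator agree for norm v < 2^j (\<delta>
  / 2), so the tail estimate with N = 1 leaves an error of order 2^(-j). The other half of \<delta>
  is the room in which x may move.\<close>

lemma convolution_jump:
  fixes f \<phi>0 \<phi> :: "real^'n::finite \<Rightarrow> complex"
  assumes ap: "admissible_pair \<phi>0 \<phi>"
    and f [measurable]: "f \<in> borel_measurable borel" and fB: "\<And>x. norm (f x) \<le> B"
    and \<delta>: "0 < \<delta>"
    and jump: "\<forall>y. (\<forall>l. \<bar>y $ l - z $ l\<bar> < \<delta>) \<longrightarrow> f y = (if z $ i \<le> y $ i then c else 0)"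
  obtains K where "\<And>j x. 0 < j \<Longrightarrow> \<forall>l. \<bar>x $ l - z $ l\<bar> \<le> \<delta> / 2 \<Longrightarrow>
    norm (convolution_dist (phi_seq \<phi>0 \<phi> j) (regular_dist f) x -
      c * cumulative i \<phi> (2 ^ j * (x $ i - z $ i))) \<le> K / 2 ^ j"
proof -
  have S: "\<phi>0 \<in> Schwartz" "\<phi> \<in> Schwartz" using ap by (auto simp: admissible_pair_def)
  obtain C where C: "C \<ge> 0"
    "\<And>g h B r. \<lbrakk>g \<in> borel_measurable borel; h \<in> borel_measurable borel; \<And>v. norm (g v) \<le> B;
      \<And>v. norm (h v) \<le> B; 0 \<le> r; \<And>v. norm v < r \<Longrightarrow> g v = h v\<rbrakk> \<Longrightarrow>
      norm ((LINT v|lborel. g v * \<phi> v) - (LINT v|lborel. h v * \<phi> v)) \<le> C * B * inverse ((1 + r) ^ 1)"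
    using integral_diff_tail[OF S(2), of 1] by blast
  define B' where "B' = max B (norm c)"
  have B': "0 \<le> B'" by (simp add: B'_def le_max_iff_disj)
  define K where "K = C * B' * (2 / \<delta>)"
  have "norm (convolution_dist (phi_seq \<phi>0 \<phi> j) (regular_dist f) x -
      c * cumulative i \<phi> (2 ^ j * (x $ i - z $ i))) \<le> K / 2 ^ j"
    if j: "0 < j" and x: "\<forall>l. \<bar>x $ l - z $ l\<bar> \<le> \<delta> / 2" for j x
  proof -
    define t where "t = 2 ^ j * (x $ i - z $ i)"
    have eq: "f (x - (1 / 2 ^ j) *\<^sub>R v) = c * indicator {..t} (v $ i)" if v: "norm v < 2 ^ j * (\<delta> / 2)" for v
    proof -
      have "\<bar>(x - (1 / 2 ^ j) *\<^sub>R v) $ l - z $ l\<bar> < \<delta>" for l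
      proof -
        have "\<bar>v $ l\<bar> < 2 ^ j * (\<delta> / 2)"
          using component_le_norm_cart[of v l] v by linarith
        then have "\<bar>v $ l / 2 ^ j\<bar> < \<delta> / 2" by (simp add: field_simps)
        moreover have "(x - (1 / 2 ^ j) *\<^sub>R v) $ l - z $ l = (x $ l - z $ l) - v $ l / 2 ^ j" by simp
        ultimately show ?thesis using x[rule_format, of l] by linarith
      qed
      \<comment> \<open>The reflection in x - 2^(-j) v turns the upper half-space into the lower
        half-line for \<open>v $ i\<close>.\<close>
      moreover have "z $ i \<le> (x - (1 / 2 ^ j) *\<^sub>R v) $ i \<longleftrightarrow> v $ i \<le> t"
        by (simp add: t_def field_simps)
      ultimately show ?thesis by (simp add: jump indicator_def)
    qed
    have "convolution_dist (phi_seq \<phi>0 \<phi> j) (regular_dist f) x = (LINT v|lborel. f (x - (1 / 2 ^ j) *\<^sub>R v) * \<phi> v)"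
      using j by (simp add: convolution_regular_dist[OF S f] mother_def)
    moreover have "c * cumulative i \<phi> t = (LINT v|lborel. (c * indicator {..t} (v $ i)) * \<phi> v)"
      by (simp add: cumulative_def mult.assoc)
    moreover have "norm ((LINT v|lborel. f (x - (1 / 2 ^ j) *\<^sub>R v) * \<phi> v) -
        (LINT v|lborel. (c * indicator {..t} (v $ i)) * \<phi> v)) \<le> C * B' * inverse ((1 + 2 ^ j * (\<delta> / 2)) ^ 1)"
    proof (rule C(2))
      show "norm (f (x - (1 / 2 ^ j) *\<^sub>R v)) \<le> B'" for v
        using fB by (simp add: B'_def le_max_iff_disj)
      show "norm (c * indicator {..t} (v $ i)) \<le> B'" for v
        by (auto simp: B'_def indicator_def le_max_iff_disj)
    qed (use \<delta> eq in auto)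
    moreover have "inverse ((1 + 2 ^ j * (\<delta> / 2)) ^ 1) \<le> inverse (2 ^ j * (\<delta> / 2))"
      using \<delta> by (intro le_imp_inverse_le) auto
    then have "C * B' * inverse ((1 + 2 ^ j * (\<delta> / 2)) ^ 1) \<le> C * B' * inverse (2 ^ j * (\<delta> / 2))"
      using C(1) B' by (intro mult_left_mono) auto
    moreover have "C * B' * inverse (2 ^ j * (\<delta> / 2)) = K / 2 ^ j"
      using \<delta> by (simp add: K_def field_simps)
    ultimately show ?thesis by (simp add: t_def)
  qed
  then show thesis using that by blast
qed

text \<open>Chebyshev's inequality in a form that includes p = \<infinity>: there
  \<open>\<mu> powr recip p\<close> is 1, and the argument is that E is not a null set.\<close>

lemma Lp_norm_ge_const_on:
  fixes g :: "real^'n::finite \<Rightarrow> complex"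
  assumes p: "0 < p" and E: "E \<in> sets borel" "E \<subseteq> P" "emeasure lborel E = ennreal \<mu>" "0 < \<mu>"
    and P: "P \<in> sets borel" and \<eta>: "0 < \<eta>" "\<And>x. x \<in> E \<Longrightarrow> \<eta> \<le> norm (g x)"
  shows "ennreal (\<eta> * \<mu> powr recip p) \<le> Lp_norm p P g"
proof (cases "p = \<infinity>")
  case True
  have "ennreal \<eta> \<le> Lp_norm p P g"
  proof (rule ccontr)
    assume "\<not> ?thesis"
    then have less: "Lp_norm p P g < ennreal \<eta>" by simp
    have "AE x in restrict_space lborel P. ennreal (norm (g x)) \<le> Lp_norm p P g"
      unfolding Lp_norm_def if_P[OF True] by (rule esssup_AE)
    then have "AE x in lborel. x \<in> P \<longrightarrow> ennreal (norm (g x)) \<le> Lp_norm p P g"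
      using P by (subst (asm) AE_restrict_space_iff) auto
    then have "AE x in lborel. x \<notin> E"
    proof (rule AE_mp, intro AE_I2 impI notI)
      fix x assume "x \<in> P \<longrightarrow> ennreal (norm (g x)) \<le> Lp_norm p P g" "x \<in> E"
      then have "ennreal (norm (g x)) < ennreal \<eta>" using less E(2) by (auto intro: le_less_trans)
      then show False using \<eta>(2)[OF \<open>x \<in> E\<close>] ennreal_leI by (metis not_le)
    qed
    then have "emeasure lborel E = 0"
      using E(1) by (subst (asm) AE_iff_null_sets[symmetric]) auto
    then show False using E(3,4) by simp
  qed
  then show ?thesis using True E(4) by (simp add: recip_def)
next
  case False
  define p' where "p' = enn2real p"
  have p': "0 < p'" using enn2real_pos[OF p False] by (simp add: p'_def)
  have rp: "recip p = 1 / p'"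
    using recip_finite[OF p False] by (simp add: p'_def)
  have "ennreal (\<eta> powr p' * \<mu>) = (\<integral>\<^sup>+x. ennreal (\<eta> powr p') * indicator E x \<partial>lborel)"
    using E by (simp add: nn_integral_cmult_indicator ennreal_mult)
  also have "\<dots> \<le> (\<integral>\<^sup>+x\<in>P. ennreal (norm (g x) powr p') \<partial>lborel)"
    using E(2) \<eta> p' by (intro nn_integral_mono) (auto simp: indicator_def intro!: ennreal_leI powr_mono2)
  finally have "ennreal_power (ennreal (\<eta> powr p' * \<mu>)) (1 / p') \<le>
      ennreal_power (\<integral>\<^sup>+x\<in>P. ennreal (norm (g x) powr p') \<partial>lborel) (1 / p')"
    using p' by (intro ennreal_power_mono) auto
  then show ?thesis
    using False \<eta>(1) E(4) p' by (simp add: Lp_norm_def p'_def[symmetric] ennreal_power_ennreal powr_mult powr_powr rp)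
qed

text \<open>The norm is bounded below on a slab E of a cube with corner z: thickness (b - a) 2^(-j)
  in direction i and full side 2^(-J) in the others. Its measure has the order of the strip in the
  upper bound.\<close>

lemma Lp_norm_lower_bound:
  fixes f \<phi>0 \<phi> :: "real^'n::finite \<Rightarrow> complex"
  assumes ap: "admissible_pair \<phi>0 \<phi>"
    and f: "f \<in> borel_measurable borel" "\<And>x. norm (f x) \<le> B"
    and \<delta>: "0 < \<delta>" and c: "c \<noteq> 0"
    and jump: "\<forall>y. (\<forall>l. \<bar>y $ l - z $ l\<bar> < \<delta>) \<longrightarrow> f y = (if z $ i \<le> y $ i then c else 0)"
    and z: "\<And>l. 2 ^ M * z $ l \<in> \<int>"
    and p: "0 < p"
  obtains C J0 L where "0 < C"
    and "\<And>J. J0 \<le> J \<Longrightarrow> \<exists>k. \<forall>j\<ge>J + L. ennreal (C * 2 powr (- (real j + real J * (real CARD('n) - 1)) * recip p))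
      \<le> Lp_norm p (dyadic_cube (int J) k) (convolution_dist (phi_seq \<phi>0 \<phi> j) (regular_dist f))"
proof -
  obtain a b c0 where ab: "a < b" "0 < a \<or> b < 0" and c0: "0 < c0"
    "\<And>t. a \<le> t \<Longrightarrow> t \<le> b \<Longrightarrow> c0 \<le> norm (cumulative i \<phi> t)"
    using cumulative_interval[OF ap, where i=i] by blast
  obtain K where K: "\<And>j x. 0 < j \<Longrightarrow> \<forall>l. \<bar>x $ l - z $ l\<bar> \<le> \<delta> / 2 \<Longrightarrow>
    norm (convolution_dist (phi_seq \<phi>0 \<phi> j) (regular_dist f) x -
      c * cumulative i \<phi> (2 ^ j * (x $ i - z $ i))) \<le> K / 2 ^ j"
    using convolution_jump[OF ap f \<delta> jump] by blast
  \<comment> \<open>Half of the lower bound for the main term; the other half absorbs the error of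
    the comparison.\<close>
  define \<eta> where "\<eta> = norm c * c0 / 2"
  have \<eta>: "0 < \<eta>" using c c0 by (simp add: \<eta>_def)
  \<comment> \<open>The first entry makes the error at most \<eta> once j \<ge> L, the second makes
    the slab fit into the cube once j \<ge> J + L.\<close>
  obtain L where L: "max (K / \<eta>) (\<bar>a\<bar> + \<bar>b\<bar>) < 2 ^ L"
    using real_arch_pow[of 2 "max (K / \<eta>) (\<bar>a\<bar> + \<bar>b\<bar>)"] by auto
  obtain J1 where J1: "2 / \<delta> < 2 ^ J1" using real_arch_pow[of 2 "2 / \<delta>"] by auto
  \<comment> \<open>\<open>M\<close> makes z a lattice point of level J, \<open>J1\<close> makes the
    side at most \<delta> / 2, and \<open>Suc\<close> ensures j > 0, where the kernel is
    \<open>\<phi>\<close>.\<close>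
  define J0 where "J0 = Suc (max M J1)"
  define C where "C = \<eta> * (b - a) powr recip p"
  show thesis
  proof (rule that)
    show "0 < C" using \<eta> ab by (simp add: C_def)
    fix J assume J: "J0 \<le> J"
    define w where "w = 1 / (2::real) ^ J"
    have w: "0 < w" by (simp add: w_def)
    have wpowr: "w = 2 powr (- real_of_int (int J))" by (simp add: w_def powr_minus_divide powr_realpow)
    have w\<delta>: "w \<le> \<delta> / 2"
    proof -
      have "(2::real) ^ J1 \<le> 2 ^ J" using J by (intro power_increasing) (auto simp: J0_def)
      then have "2 / \<delta> \<le> 2 ^ J" using J1 by linarith
      then show ?thesis using \<delta> by (simp add: w_def field_simps)
    qed
    define m where "m l = \<lfloor>2 ^ J * z $ l\<rfloor>" for l
    \<comment> \<open>If b < 0 the slab lies below z in direction i, so the cube on that side of the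
      wall is taken.\<close>
    define k where "k = (\<chi> l. m l + (if l = i \<and> b < 0 then -1 else 0))"
    have zint: "of_int (m l) = 2 ^ J * z $ l" for l
    proof -
      have "(2::real) ^ J * z $ l = of_int (2 ^ (J - M)) * (2 ^ M * z $ l)"
        using J by (simp add: J0_def power_add[symmetric])
      then have "2 ^ J * z $ l \<in> \<int>" using Ints_mult[OF Ints_of_int z] by metis
      then show ?thesis by (simp add: m_def)
    qed
    have wk: "w * of_int (k $ l) = z $ l + (if l = i \<and> b < 0 then - w else 0)" for l
      by (simp add: k_def zint w_def field_simps)
    have int: "dyadic_interval (int J) (k $ l) =
        {z $ l + (if l = i \<and> b < 0 then - w else 0) ..< z $ l + (if l = i \<and> b < 0 then 0 else w)}" for l
      unfolding dyadic_interval_def wpowr[symmetric] distrib_left wk by simp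
    have near: "\<bar>x $ l - z $ l\<bar> \<le> \<delta> / 2" if "x \<in> dyadic_cube (int J) k" for x l
    proof -
      have "x $ l \<in> dyadic_interval (int J) (k $ l)" using that by (simp add: dyadic_cube_iff)
      then show ?thesis using w\<delta> w unfolding int by (auto split: if_splits)
    qed
    have "ennreal (C * 2 powr (- (real j + real J * (real CARD('n) - 1)) * recip p))
      \<le> Lp_norm p (dyadic_cube (int J) k) (convolution_dist (phi_seq \<phi>0 \<phi> j) (regular_dist f))"
      if j: "J + L \<le> j" for j
    proof -
      have j0: "0 < j" using j J by (simp add: J0_def)
      define I where "I l = (if l = i then {z $ i + a / 2 ^ j .. z $ i + b / 2 ^ j}
        else dyadic_interval (int J) (k $ l))" for l
      define E where "E = {x. \<forall>l. x $ l \<in> I l}"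
      have Im: "I l \<in> sets borel" for l by (simp add: I_def)
      have pow: "(2::real) ^ L / 2 ^ j \<le> w"
      proof -
        have "(2::real) ^ (J + L) \<le> 2 ^ j" using j by (intro power_increasing) auto
        then show ?thesis by (simp add: w_def field_simps power_add)
      qed
      have ab_le: "\<bar>a\<bar> / 2 ^ j < w" "\<bar>b\<bar> / 2 ^ j < w"
        using L by (auto intro!: less_le_trans[OF divide_strict_right_mono pow])
      have sub: "E \<subseteq> dyadic_cube (int J) k"
      proof
        fix x assume x: "x \<in> E"
        have "x $ l \<in> dyadic_interval (int J) (k $ l)" for l
        proof (cases "l = i")
          case False
          then show ?thesis using x[unfolded E_def mem_Collect_eq, rule_format, of l] by (simp add: I_def)
        next
          case True
          then have xi: "z $ i + a / 2 ^ j \<le> x $ i" "x $ i \<le> z $ i + b / 2 ^ j"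
            using x[unfolded E_def mem_Collect_eq, rule_format, of i] by (auto simp: I_def)
          show ?thesis
          proof (cases "b < 0")
            case True
            then have "\<bar>a\<bar> = - a" "b / 2 ^ j < 0" using ab by (auto simp: divide_neg_pos)
            then show ?thesis using xi ab_le(1) True \<open>l = i\<close> by (auto simp: int)
          next
            case False
            then have "0 < a" "0 < b" using ab by auto
            then have "\<bar>b\<bar> = b" "0 < a / 2 ^ j" by auto
            then show ?thesis using xi ab_le(2) False \<open>l = i\<close> by (auto simp: int)
          qed
        qed
        then show "x \<in> dyadic_cube (int J) k" by (simp add: dyadic_cube_iff)
      qed
      define \<mu> where "\<mu> = (b - a) * 2 powr (- (real j + real J * (real CARD('n) - 1)))"
      have \<mu>: "emeasure lborel E = ennreal \<mu>"
      proof -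
        have "emeasure lborel E = (\<Prod>l\<in>UNIV. emeasure lborel (I l))"
          unfolding E_def by (rule emeasure_vec_box[OF Im])
        also have "\<dots> = emeasure lborel (I i) * (\<Prod>l\<in>UNIV - {i}. emeasure lborel (I l))"
          by (simp add: prod.remove[of UNIV i])
        also have "(\<Prod>l\<in>UNIV - {i}. emeasure lborel (I l)) = (\<Prod>l\<in>UNIV - {i}. ennreal w)"
          by (intro prod.cong) (auto simp: I_def emeasure_dyadic_interval wpowr)
        also have "\<dots> = ennreal (2 powr (- (real J * (real CARD('n) - 1))))"
          using w by (simp add: ennreal_power wpowr powr_power of_nat_diff mult.commute)
        also have "emeasure lborel (I i) = ennreal ((b - a) * 2 powr (- real j))"
          using ab by (simp add: I_def powr_minus_divide powr_realpow diff_divide_distrib divide_right_mono)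
        finally show ?thesis
          using ab by (simp add: \<mu>_def ennreal_mult[symmetric] powr_add[symmetric])
      qed
      have "\<eta> \<le> norm (convolution_dist (phi_seq \<phi>0 \<phi> j) (regular_dist f) x)" if x: "x \<in> E" for x
      proof -
        define t where "t = 2 ^ j * (x $ i - z $ i)"
        have "x $ i \<in> I i" using x by (simp add: E_def)
        then have t: "a \<le> t" "t \<le> b" by (auto simp: I_def t_def field_simps)
        have "2 * \<eta> \<le> norm (c * cumulative i \<phi> t)"
          using c0(2)[OF t] by (simp add: \<eta>_def norm_mult mult_left_mono)
        moreover have "norm (convolution_dist (phi_seq \<phi>0 \<phi> j) (regular_dist f) x - c * cumulative i \<phi> t) \<le> K / 2 ^ j"
          unfolding t_def using x sub near by (intro K j0) blast
        moreover have "K / 2 ^ j \<le> \<eta>"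
        proof -
          have "(2::real) ^ L \<le> 2 ^ j" using j by (intro power_increasing) auto
          moreover have "K / \<eta> < 2 ^ L" using L by simp
          ultimately have "K / \<eta> \<le> 2 ^ j" by linarith
          then show ?thesis using \<eta> by (simp add: field_simps)
        qed
        ultimately show ?thesis
          using norm_triangle_ineq2[of "c * cumulative i \<phi> t" "convolution_dist (phi_seq \<phi>0 \<phi> j) (regular_dist f) x"]
          by (simp add: norm_minus_commute)
      qed
      moreover have "E \<in> sets borel" unfolding E_def by (rule vec_box_measurable[OF Im])
      moreover have "0 < \<mu>" using ab by (simp add: \<mu>_def)
      ultimately have "ennreal (\<eta> * \<mu> powr recip p) \<le>
          Lp_norm p (dyadic_cube (int J) k) (convolution_dist (phi_seq \<phi>0 \<phi> j) (regular_dist f))"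
        using p sub \<mu> \<eta> by (intro Lp_norm_ge_const_on) auto
      moreover have "\<eta> * \<mu> powr recip p = C * 2 powr (- (real j + real J * (real CARD('n) - 1)) * recip p)"
        using ab by (simp add: \<mu>_def C_def powr_mult powr_powr)
      ultimately show ?thesis by simp
    qed
    then show "\<exists>k. \<forall>j\<ge>J + L. ennreal (C * 2 powr (- (real j + real J * (real CARD('n) - 1)) * recip p))
      \<le> Lp_norm p (dyadic_cube (int J) k) (convolution_dist (phi_seq \<phi>0 \<phi> j) (regular_dist f))"
      by blast
  qed
qed

section \<open>The Haar system\<close>

definition haar_factor :: "bool \<Rightarrow> real \<Rightarrow> complex" where
  "haar_factor b = (if b then h_tilde else X_tilde)"

lemma haar_factor_simps:
  "0 \<le> t \<Longrightarrow> t < 1/2 \<Longrightarrow> haar_factor b t = 1"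
  "1/2 \<le> t \<Longrightarrow> t < 1 \<Longrightarrow> haar_factor b t = (if b then -1 else 1)"
  "t < 0 \<Longrightarrow> haar_factor b t = 0"
  "1 \<le> t \<Longrightarrow> haar_factor b t = 0"
  by (auto simp: haar_factor_def h_tilde_def X_tilde_def)

lemma haar_factor_norm: "norm (haar_factor b t) \<le> 1"
  by (cases "t < 0"; cases "t < 1/2"; cases "t < 1") (auto simp: haar_factor_simps)

lemma haar_factor_const:
  assumes "\<And>a. a \<in> {0, 1/2, 1} \<Longrightarrow> e \<le> \<bar>t - a\<bar>" "\<bar>t' - t\<bar> < e"
  shows "haar_factor b t' = haar_factor b t"
proof -
  have e: "e \<le> \<bar>t\<bar>" "e \<le> \<bar>t - 1/2\<bar>" "e \<le> \<bar>t - 1\<bar>"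
    using assms(1)[of 0] assms(1)[of "1/2"] assms(1)[of 1] by auto
  consider "t < 0" | "0 \<le> t" "t < 1/2" | "1/2 \<le> t" "t < 1" | "1 \<le> t" by linarith
  then show ?thesis
  proof cases
    case 1
    then have "t' < 0" using e assms(2) by linarith
    then show ?thesis using 1 by (simp add: haar_factor_simps)
  next
    case 2
    then have "0 \<le> t'" "t' < 1/2" using e assms(2) by linarith+
    then show ?thesis using 2 by (simp add: haar_factor_simps)
  next
    case 3
    then have "1/2 \<le> t'" "t' < 1" using e assms(2) by linarith+
    then show ?thesis using 3 by (simp add: haar_factor_simps)
  next
    case 4
    then have "1 \<le> t'" using e assms(2) by linarith
    then show ?thesis using 4 by (simp add: haar_factor_simps)
  qed
qed

lemma haar_factor_measurable [measurable]: "haar_factor b \<in> borel_measurable borel"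
  unfolding haar_factor_def h_tilde_def[abs_def] X_tilde_def by auto

lemma haar_eq_prod:
  fixes \<epsilon> :: "bool^'n::finite"
  shows "haar \<epsilon> j m x = complex_of_real (2 powr (real (j * CARD('n)) / 2)) *
    (\<Prod>l\<in>UNIV. haar_factor (\<epsilon> $ l) (2 ^ j * x $ l - of_int (m $ l)))"
proof -
  have "(\<Prod>l\<in>UNIV. haar_factor (\<epsilon> $ l) (y $ l)) = haar_gen \<epsilon> y" for y :: "real^'n"
  proof -
    have "(\<Prod>l\<in>UNIV. haar_factor (\<epsilon> $ l) (y $ l)) = (\<Prod>l\<in>UNIV. if \<epsilon> $ l then h_tilde (y $ l) else X_tilde (y $ l))"
      by (intro prod.cong) (auto simp: haar_factor_def)
    also have "\<dots> = haar_gen \<epsilon> y"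
      by (subst prod.If_cases) (auto simp: haar_gen_def mult.commute Collect_neg_eq)
    finally show ?thesis .
  qed
  from this[of "2 ^ j *\<^sub>R x - (\<chi> i. of_int (m $ i))"] show ?thesis
    by (simp add: haar_def)
qed

lemma haar_measurable: "haar \<epsilon> j (m :: int^'n::finite) \<in> borel_measurable borel"
  unfolding haar_eq_prod[abs_def] by measurable

lemma haar_norm: "norm (haar \<epsilon> j (m :: int^'n::finite) x) \<le> 2 powr (real (j * CARD('n)) / 2)"
proof -
  have "(\<Prod>l\<in>(UNIV::'n set). norm (haar_factor (\<epsilon> $ l) (2 ^ j * x $ l - of_int (m $ l)))) \<le> 1"
    by (intro prod_le_1) (auto simp: haar_factor_norm)
  then show ?thesis
    by (simp add: haar_eq_prod norm_mult prod_norm[symmetric])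
qed

text \<open>The points 0, 1/2, 1 serve both types of factor, so one set of walls does for every
  \<epsilon>.\<close>

definition haar_walls :: "nat \<Rightarrow> int^'n::finite \<Rightarrow> ('n \<times> real) set" where
  "haar_walls j m = (\<lambda>(l, a). (l, (of_int (m $ l) + a) / 2 ^ j)) ` (UNIV \<times> {0, 1/2, 1})"

lemma haar_locally_constant:
  fixes m :: "int^'n::finite"
  assumes d: "\<forall>(l, a)\<in>haar_walls j m. d \<le> \<bar>x $ l - a\<bar>" and y: "norm (y - x) < d"
  shows "haar \<epsilon> j m y = haar \<epsilon> j m x"
proof -
  have "haar_factor (\<epsilon> $ l) (2 ^ j * y $ l - of_int (m $ l)) = haar_factor (\<epsilon> $ l) (2 ^ j * x $ l - of_int (m $ l))" for l
  proof (rule haar_factor_const)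
    fix a :: real assume a: "a \<in> {0, 1/2, 1}"
    then have "(l, (of_int (m $ l) + a) / 2 ^ j) \<in> haar_walls j m"
      by (auto simp: haar_walls_def)
    then have "d \<le> \<bar>x $ l - (of_int (m $ l) + a) / 2 ^ j\<bar>" using d by blast
    then have "2 ^ j * d \<le> 2 ^ j * \<bar>x $ l - (of_int (m $ l) + a) / 2 ^ j\<bar>" by simp
    also have "\<dots> = \<bar>2 ^ j * (x $ l - (of_int (m $ l) + a) / 2 ^ j)\<bar>" by (simp add: abs_mult)
    also have "2 ^ j * (x $ l - (of_int (m $ l) + a) / 2 ^ j) = 2 ^ j * x $ l - of_int (m $ l) - a"
      by (simp add: field_simps)
    finally show "2 ^ j * d \<le> \<bar>2 ^ j * x $ l - of_int (m $ l) - a\<bar>" .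
  next
    have "\<bar>y $ l - x $ l\<bar> < d" using component_le_norm_cart[of "y - x" l] y by simp
    moreover have "(2 ^ j * y $ l - of_int (m $ l)) - (2 ^ j * x $ l - of_int (m $ l)) = 2 ^ j * (y $ l - x $ l)"
      by (simp add: algebra_simps)
    ultimately show "\<bar>(2 ^ j * y $ l - of_int (m $ l)) - (2 ^ j * x $ l - of_int (m $ l))\<bar> < 2 ^ j * d"
      by (simp add: abs_mult)
  qed
  then show ?thesis by (simp add: haar_eq_prod)
qed

text \<open>A crude radius from the l^1 norm; it does not involve j because 2^j \<ge> 1.\<close>

lemma haar_support:
  fixes m :: "int^'n::finite"
  assumes "(\<Sum>l\<in>UNIV. \<bar>real_of_int (m $ l)\<bar> + 1) < norm y"
  shows "haar \<epsilon> j m y = 0"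
proof (rule ccontr)
  assume "haar \<epsilon> j m y \<noteq> 0"
  then have nz: "haar_factor (\<epsilon> $ l) (2 ^ j * y $ l - of_int (m $ l)) \<noteq> 0" for l
    by (auto simp: haar_eq_prod)
  have "\<bar>y $ l\<bar> \<le> \<bar>real_of_int (m $ l)\<bar> + 1" for l
  proof -
    have "0 \<le> 2 ^ j * y $ l - of_int (m $ l)" "2 ^ j * y $ l - of_int (m $ l) < 1"
      using nz[of l] haar_factor_simps(3,4) by (meson not_le)+
    then have "\<bar>2 ^ j * y $ l\<bar> \<le> \<bar>real_of_int (m $ l)\<bar> + 1" by linarith
    moreover have "\<bar>y $ l\<bar> \<le> 2 ^ j * \<bar>y $ l\<bar>" by (simp add: mult_le_cancel_right1)
    ultimately show ?thesis by (simp add: abs_mult)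
  qed
  then have "norm y \<le> (\<Sum>l\<in>UNIV. \<bar>real_of_int (m $ l)\<bar> + 1)"
    by (intro order_trans[OF norm_le_l1_cart] sum_mono)
  then show False using assms by simp
qed

text \<open>Both types of factor equal 1 on [0, 1/2), and 1/4 is the middle of this interval. Within
  the given radius the other rescaled coordinates stay in it and the i-th stays below 1/2, so
  \<epsilon> leaves no trace and only the jump at the lower face is seen.\<close>

lemma haar_jump:
  fixes m :: "int^'n::finite" and i :: 'n and j :: nat
  defines "z \<equiv> \<chi> l. (of_int (m $ l) + (if l = i then 0 else 1/4)) / 2 ^ j"
  assumes y: "\<forall>l. \<bar>y $ l - z $ l\<bar> < 1 / 4 / 2 ^ j"
  shows "haar \<epsilon> j m y = (if z $ i \<le> y $ i then complex_of_real (2 powr (real (j * CARD('n)) / 2)) else 0)"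
proof -
  define t where "t l = 2 ^ j * y $ l - of_int (m $ l)" for l
  have t: "\<bar>t l - (if l = i then 0 else 1/4)\<bar> < 1/4" for l
  proof -
    have "2 ^ j * \<bar>y $ l - z $ l\<bar> < 1 / 4"
      using y[rule_format, of l] by (simp add: field_simps)
    moreover have "2 ^ j * (y $ l - z $ l) = t l - (if l = i then 0 else 1/4)"
      by (simp add: t_def z_def field_simps)
    moreover have "2 ^ j * \<bar>y $ l - z $ l\<bar> = \<bar>2 ^ j * (y $ l - z $ l)\<bar>" by (simp add: abs_mult)
    ultimately show ?thesis by simp
  qed
  have i: "z $ i \<le> y $ i \<longleftrightarrow> 0 \<le> t i"
    by (simp add: t_def z_def field_simps)
  show ?thesis
  proof (cases "0 \<le> t i")
    case True
    have "haar_factor (\<epsilon> $ l) (t l) = 1" for l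
    proof -
      have "0 \<le> t l \<and> t l < 1/2"
        using t[of l] True by (cases "l = i") (auto simp: abs_if split: if_splits)
      then show ?thesis by (simp add: haar_factor_simps)
    qed
    then show ?thesis using True i by (simp add: haar_eq_prod t_def[symmetric])
  next
    case False
    then have "haar_factor (\<epsilon> $ i) (t i) = 0" by (simp add: haar_factor_simps)
    then have "(\<Prod>l\<in>UNIV. haar_factor (\<epsilon> $ l) (t l)) = 0" by (intro prod_zero bexI[of _ i]) auto
    then show ?thesis using False i by (simp add: haar_eq_prod t_def[symmetric])
  qed
qed

text \<open>The criterion contains none of \<epsilon>, j and m. This is the source of the
  equivalences between Haar functions, and the constant vector \<open>False\<close> gives the
  characteristic functions of cubes.\<close>

lemma haar_in_besov_type_iff:
  fixes \<phi>0 \<phi> :: "real^'n::finite \<Rightarrow> complex" and m :: "int^'n"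
  assumes ap: "admissible_pair \<phi>0 \<phi>" and p: "0 < p" and q: "0 < q" and \<tau>: "0 \<le> \<tau>"
  shows "regular_dist (haar \<epsilon> j m) \<in> besov_type \<phi>0 \<phi> s \<tau> p q \<longleftrightarrow>
    s \<le> real CARD('n) * (recip p - \<tau>) \<and> (s < recip p \<or> s = recip p \<and> q = \<infinity>)"
proof -
  have temp: "regular_dist (haar \<epsilon> j m) \<in> tempered_distributions"
    by (rule regular_dist_tempered[OF haar_measurable haar_norm])
  have W: "finite (haar_walls j m)" "haar_walls j m \<noteq> {}"
    by (auto simp: haar_walls_def)
  have const: "\<forall>x y d. (\<forall>(i, a)\<in>haar_walls j m. d \<le> \<bar>x $ i - a\<bar>) \<longrightarrow> norm (y - x) < d \<longrightarrow>
      haar \<epsilon> j m y = haar \<epsilon> j m x"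
    using haar_locally_constant by blast
  have supp: "0 \<le> (\<Sum>l\<in>UNIV. \<bar>real_of_int (m $ l)\<bar> + 1)"
    "\<forall>y. (\<Sum>l\<in>UNIV. \<bar>real_of_int (m $ l)\<bar> + 1) < norm y \<longrightarrow> haar \<epsilon> j m y = 0"
    using haar_support by (auto intro!: sum_nonneg)
  have "besov_type_norm \<phi>0 \<phi> s \<tau> p q (regular_dist (haar \<epsilon> j m)) < \<infinity>"
    if s: "s \<le> real CARD('n) * (recip p - \<tau>)" "s < recip p \<or> s = recip p \<and> q = \<infinity>"
  proof -
    obtain C where C: "0 < C" "\<And>J k j'. Lp_norm p (dyadic_cube J k) (convolution_dist (phi_seq \<phi>0 \<phi> j') (regular_dist (haar \<epsilon> j m))) \<le>
      ennreal (C * 2 powr (- (real j' + real (nat J) * (real CARD('n) - 1)) * recip p))"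
      by (rule Lp_norm_upper_bound[OF ap haar_measurable haar_norm W const supp p]) (rule that)
    show ?thesis by (rule besov_type_norm_finiteI[OF \<tau> q C s])
  qed
  moreover have "s \<le> real CARD('n) * (recip p - \<tau>) \<and> (s < recip p \<or> s = recip p \<and> q = \<infinity>)"
    if fin: "besov_type_norm \<phi>0 \<phi> s \<tau> p q (regular_dist (haar \<epsilon> j m)) < \<infinity>"
  proof -
    \<comment> \<open>Any direction will do; the index type is nonempty.\<close>
    obtain i :: 'n where True by blast
    define z :: "real^'n" where "z = (\<chi> l. (of_int (m $ l) + (if l = i then 0 else 1/4)) / 2 ^ j)"
    define c where "c = complex_of_real (2 powr (real (j * CARD('n)) / 2))"
    have c: "c \<noteq> 0" by (simp add: c_def)
    have jump: "\<forall>y. (\<forall>l. \<bar>y $ l - z $ l\<bar> < 1 / 4 / 2 ^ j) \<longrightarrow> haar \<epsilon> j m y = (if z $ i \<le> y $ i then c else 0)"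
      using haar_jump unfolding z_def c_def by blast
    \<comment> \<open>The exponent j + 2 clears 2^j from the scale and 4 from the quarter.\<close>
    have zint: "2 ^ (j + 2) * z $ l \<in> \<int>" for l
    proof -
      have "2 ^ (j + 2) * z $ l = of_int (4 * m $ l + (if l = i then 0 else 1))"
        by (simp add: z_def power_add)
      then show ?thesis by (metis Ints_of_int)
    qed
    obtain C J0 L where C: "0 < C"
      "\<And>J. J0 \<le> J \<Longrightarrow> \<exists>k. \<forall>j'\<ge>J + L. ennreal (C * 2 powr (- (real j' + real J * (real CARD('n) - 1)) * recip p))
      \<le> Lp_norm p (dyadic_cube (int J) k) (convolution_dist (phi_seq \<phi>0 \<phi> j') (regular_dist (haar \<epsilon> j m)))"
      by (rule Lp_norm_lower_bound[OF ap haar_measurable haar_norm _ c jump zint p]) (simp, rule that)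
    show ?thesis using besov_type_norm_finiteD[OF q C fin] by blast
  qed
  ultimately show ?thesis using temp by (auto simp: besov_type_def)
qed

theorem theorem2p1:
  fixes \<phi>0 \<phi> :: "real^'n::finite \<Rightarrow> complex" and s :: real and p q :: ennreal
  assumes "admissible_pair \<phi>0 \<phi>" and "0 < p" and "0 < q"
  shows
    "(\<forall>\<tau>. recip p < \<tau> \<longrightarrow>
        (regular_dist X_cube \<in> besov_type \<phi>0 \<phi> s \<tau> p q \<longleftrightarrow>
          s \<le> real CARD('n) * (recip p - \<tau>))) \<and>
     (\<forall>\<tau>. 0 \<le> \<tau> \<and> \<tau> \<le> recip p \<longrightarrow>
        (regular_dist X_cube \<in> besov_type \<phi>0 \<phi> s \<tau> p q \<longleftrightarrow>
          (s = recip p \<and> q = \<infinity> \<and> s \<le> real CARD('n) * (recip p - \<tau>)) \<or>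
          (s < recip p \<and> 0 < q \<and> q \<le> \<infinity> \<and> s \<le> real CARD('n) * (recip p - \<tau>)))) \<and>
     (\<forall>\<tau>. 0 \<le> \<tau> \<longrightarrow>
        (\<forall>\<epsilon>::bool^'n. \<forall>(j::nat) (m::int^'n). \<epsilon> \<noteq> (\<chi> i. False) \<longrightarrow>
          (regular_dist (haar \<epsilon> j m) \<in> besov_type \<phi>0 \<phi> s \<tau> p q \<longleftrightarrow>
            regular_dist (X_shift 0 m) \<in> besov_type \<phi>0 \<phi> s \<tau> p q) \<and>
          (regular_dist (X_shift 0 m) \<in> besov_type \<phi>0 \<phi> s \<tau> p q \<longleftrightarrow>
            regular_dist X_cube \<in> besov_type \<phi>0 \<phi> s \<tau> p q)))"
proof -
  have X: "(X_cube :: real^'n \<Rightarrow> complex) = haar (\<chi> i. False) 0 (\<chi> i. 0)"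
    by (rule ext) (simp add: X_cube_def haar_def zero_vec_def[symmetric])
  note iff = haar_in_besov_type_iff[OF assms]
  have r: "0 \<le> recip p" by (simp add: recip_def)
  \<comment> \<open>The number n (r - \<tau>) is negative, whereas r \<ge> 0.\<close>
  have large: "s < recip p" if "recip p < \<tau>" "s \<le> real CARD('n) * (recip p - \<tau>)" for \<tau>
  proof -
    have "real CARD('n) * (recip p - \<tau>) < 0"
      using that(1) by (intro mult_pos_neg) auto
    then show ?thesis using that(2) r by linarith
  qed
  have "0 \<le> \<tau>" if "recip p < \<tau>" for \<tau> using that r by linarith
  then show ?thesis
    unfolding X X_shift_def using iff large assms(3) by (auto; meson)
qed

end
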